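(* Let $\Gamma$ and $\Gamma'$ be simplicial complexes, both of which are induced subcomplexes of $\Gamma\cup\Gamma'$. Let $\hat n$ be the number of vertices of $\Gamma\cup\Gamma'$ and $d-1$ its dimension. Let $\mathcal{F},\mathcal{F}',\hat{\mathcal{F}}$ be graded free resolutions of the Stanley-Reisner rings of $\Gamma,\Gamma',\Gamma\cup\Gamma'$ respectively, such that $M_i(\mathcal{F})\le M_i(\hat{\mathcal{F}})$ whenever $M_i(\mathcal{F})$ is defined and $M_i(\mathcal{F}')\le M_i(\hat{\mathcal{F}})$ whenever $M_i(\mathcal{F}')$ is defined. Let $t\ge0$ be the integer with $M_{\hat n-d}(\hat{\mathcal{F}})=\hat n-d+t+1$. Suppose that $\Gamma$ satisfies the $\mathcal{F}$-multiplicity upper bound conjecture and $\Gamma'$ satisfies the $\mathcal{F}'$-multiplicity upper bound conjecture. If $f_0(\Gamma\cap\Gamma')\le t+d-1$, then $\Gamma\cup\Gamma'$ satisfies the $\hat{\mathcal{F}}$-multiplicity upper bound conjecture.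
   Context: A simplicial complex $\Gamma$ on a finite vertex set $V(\Gamma)$ is a collection of subsets (faces) closed under inclusion and containing every singleton $\{v\}$, $v\in V(\Gamma)$. $f_i(\Gamma)$ is the number of $i$-dimensional faces (faces with $i+1$ elements); so $f_0$ is the number of vertices. For $W\subseteq V(\Gamma)$ the induced subcomplex $\Gamma[W]$ consists of all faces of $\Gamma$ contained in $W$. Fix a field $\mathbf{k}$; the Stanley-Reisner ring of $\Gamma$ is $S/I_\Gamma$ with $S=\mathbf{k}[x_v:v\in V(\Gamma)]$ and $I_\Gamma$ generated by squarefree monomials corresponding to non-faces. If $\Gamma$ has $n$ vertices and dimension $d-1$, then $I_\Gamma$ has codimension $n-d$ and $e(S/I_\Gamma)=f_{d-1}(\Gamma)$. A graded free resolution $\mathcal{F}$ of $S/I_\Gamma$ (not necessarily minimal) has the form $\cdots\to\bigoplus_jS(-j)^{\beta_{1,j}(\mathcal{F})}\to S\to S/I_\Gamma\to0$ with modules of finite rank; $M_i(\mathcal{F})=\max\{j:\beta_{i,j}(\mathcal{F})\ne0\}$, defined when the $i$-th module is nonzero. A complex $\Gamma$ with $n$ vertices and dimension $d-1$ satisfies the $\mathcal{F}$-multiplicity upper bound conjecture if $f_{d-1}(\Gamma)\le\frac1{(n-d)!}\prod_{i=1}^{n-d}M_i(\mathcal{F})$. *)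

theory Defs
  imports
    "HOL-Library.Poly_Mapping"
    "HOL-Algebra.QuotRing"
    "Jordan_Normal_Form.Matrix"
begin

section \<open>Simplicial complexes\<close>

text \<open>The complex is required to contain some face, hence the empty face.  This matters only for
  an empty vertex set: it excludes the void complex, which has no dimension.\<close>

definition simplicial_complex :: "'v set \<Rightarrow> 'v set set \<Rightarrow> bool" where
  "simplicial_complex V \<Delta> \<longleftrightarrow>
     finite V \<and> \<Delta> \<subseteq> Pow V \<and> \<Delta> \<noteq> {} \<and>
     (\<forall>\<sigma>\<in>\<Delta>. \<forall>\<tau>. \<tau> \<subseteq> \<sigma> \<longrightarrow> \<tau> \<in> \<Delta>) \<and>
     (\<forall>v\<in>V. {v} \<in> \<Delta>)"

definition induced_subcomplex :: "'v set set \<Rightarrow> 'v set \<Rightarrow> 'v set set" where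
  "induced_subcomplex \<Delta> W = {\<sigma> \<in> \<Delta>. \<sigma> \<subseteq> W}"

text \<open>Face dimensions are integers, since the empty face has dimension \<open>-1\<close>.\<close>

definition face_number :: "'v set set \<Rightarrow> int \<Rightarrow> nat" where
  "face_number \<Delta> i = card {\<sigma> \<in> \<Delta>. int (card \<sigma>) = i + 1}"

definition complex_dim :: "'v set set \<Rightarrow> int" where
  "complex_dim \<Delta> = int (Max (card ` \<Delta>)) - 1"


section \<open>Stanley-Reisner rings\<close>

text \<open>A monomial is a finitely supported exponent vector, a polynomial a finitely supported family
  of coefficients indexed by monomials; multiplication is convolution.\<close>

type_synonym 'v monomial = "'v \<Rightarrow>\<^sub>0 nat"
type_synonym ('v, 'k) mpoly = "'v monomial \<Rightarrow>\<^sub>0 'k"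

definition poly_carrier :: "'v set \<Rightarrow> ('v, 'k::field) mpoly set" where
  "poly_carrier V = {p. \<forall>m\<in>Poly_Mapping.keys p. Poly_Mapping.keys m \<subseteq> V}"

definition poly_ring :: "'v set \<Rightarrow> ('v, 'k::field) mpoly ring" where
  "poly_ring V =
     \<lparr>carrier = poly_carrier V, monoid.mult = (*), one = 1, zero = 0, add = (+)\<rparr>"

definition mono_degree :: "'v monomial \<Rightarrow> nat" where
  "mono_degree m = (\<Sum>v\<in>Poly_Mapping.keys m. Poly_Mapping.lookup m v)"

text \<open>The graded piece of degree \<open>j\<close>; it is \<open>{0}\<close> for negative \<open>j\<close>.\<close>

definition homogeneous_part :: "'v set \<Rightarrow> int \<Rightarrow> ('v, 'k::field) mpoly set" where
  "homogeneous_part V j =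
     {p \<in> poly_carrier V. \<forall>m\<in>Poly_Mapping.keys p. int (mono_degree m) = j}"

definition variable :: "'v \<Rightarrow> ('v, 'k::field) mpoly" where
  "variable v = Poly_Mapping.single (Poly_Mapping.single v 1) 1"

definition sr_ideal :: "'v set \<Rightarrow> 'v set set \<Rightarrow> ('v, 'k::field) mpoly set" where
  "sr_ideal V \<Delta> =
     genideal (poly_ring V) {\<Prod>v\<in>\<sigma>. variable v |\<sigma>. \<sigma> \<subseteq> V \<and> \<sigma> \<notin> \<Delta>}"

definition sr_ring :: "'v set \<Rightarrow> 'v set set \<Rightarrow> ('v, 'k::field) mpoly set ring" where
  "sr_ring V \<Delta> = poly_ring V Quot sr_ideal V \<Delta>"

definition sr_proj ::
  "'v set \<Rightarrow> 'v set set \<Rightarrow> ('v, 'k::field) mpoly \<Rightarrow> ('v, 'k) mpoly set" where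
  "sr_proj V \<Delta> p = sr_ideal V \<Delta> +>\<^bsub>poly_ring V\<^esub> p"


section \<open>Graded free resolutions\<close>

text \<open>With \<open>shifts F i = [j\<^sub>1, \<dots>, j\<^sub>r]\<close>, the \<open>i\<close>-th module is
  \<open>S(-j\<^sub>1) \<oplus> \<dots> \<oplus> S(-j\<^sub>r)\<close>, the zero module if the list is empty.  The matrix
  \<open>boundary F (i + 1)\<close> represents the map from module \<open>i + 1\<close> to module \<open>i\<close>;
  \<open>boundary F 0\<close> is not used.  Shifts are integers because a non-minimal resolution may contain
  trivial summands with generators in negative degrees.\<close>

record 'a graded_complex =
  shifts :: "nat \<Rightarrow> int list"
  boundary :: "nat \<Rightarrow> 'a mat"

definition frank :: "('v, 'k::field) mpoly graded_complex \<Rightarrow> nat \<Rightarrow> nat" where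
  "frank F i = length (shifts F i)"

definition free_module ::
  "'v set \<Rightarrow> ('v, 'k::field) mpoly graded_complex \<Rightarrow> nat \<Rightarrow> ('v, 'k) mpoly vec set" where
  "free_module V F i =
     {x \<in> carrier_vec (frank F i). \<forall>p<frank F i. x $ p \<in> poly_carrier V}"

text \<open>The third condition is that every map preserves degrees.  The fourth is exactness at module
  \<open>i + 1\<close>.  The last one is exactness at module \<open>0\<close>, which is \<open>S\<close> (seen as vectors of
  length one) and is mapped onto the Stanley-Reisner ring by the canonical projection.\<close>

definition graded_free_resolution ::
  "'v set \<Rightarrow> 'v set set \<Rightarrow> ('v, 'k::field) mpoly graded_complex \<Rightarrow> bool" where
  "graded_free_resolution V \<Delta> F \<longleftrightarrow>
     shifts F 0 = [0] \<and>
     (\<forall>i. boundary F (Suc i) \<in> carrier_mat (frank F i) (frank F (Suc i))) \<and>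
     (\<forall>i. \<forall>p<frank F i. \<forall>q<frank F (Suc i).
        boundary F (Suc i) $$ (p, q)
          \<in> homogeneous_part V (shifts F (Suc i) ! q - shifts F i ! p)) \<and>
     (\<forall>i. {x \<in> free_module V F (Suc i). boundary F (Suc i) *\<^sub>v x = 0\<^sub>v (frank F i)}
          = (\<lambda>y. boundary F (Suc (Suc i)) *\<^sub>v y) ` free_module V F (Suc (Suc i))) \<and>
     (\<lambda>y. (boundary F 1 *\<^sub>v y) $ 0) ` free_module V F 1
       = a_kernel (poly_ring V) (sr_ring V \<Delta>) (sr_proj V \<Delta>)"

definition graded_betti :: "('v, 'k::field) mpoly graded_complex \<Rightarrow> nat \<Rightarrow> int \<Rightarrow> nat" where
  "graded_betti F i j = count_list (shifts F i) j"

definition max_shift :: "('v, 'k::field) mpoly graded_complex \<Rightarrow> nat \<Rightarrow> int" where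
  "max_shift F i = Max {j. graded_betti F i j \<noteq> 0}"

definition max_shift_defined :: "('v, 'k::field) mpoly graded_complex \<Rightarrow> nat \<Rightarrow> bool" where
  "max_shift_defined F i \<longleftrightarrow> frank F i \<noteq> 0"

text \<open>The assertion that \<open>M\<^sub>i(F) \<le> M\<^sub>i(F')\<close> whenever \<open>M\<^sub>i(F)\<close> is defined; the inequality
  is understood to include that its right-hand side is defined.\<close>

definition max_shifts_le ::
  "('v, 'k::field) mpoly graded_complex \<Rightarrow> ('v, 'k) mpoly graded_complex \<Rightarrow> bool" where
  "max_shifts_le F F' \<longleftrightarrow>
     (\<forall>i. max_shift_defined F i \<longrightarrow> max_shift_defined F' i \<and> max_shift F i \<le> max_shift F' i)"

definition multiplicity_upper_bound ::
  "'v set \<Rightarrow> 'v set set \<Rightarrow> ('v, 'k::field) mpoly graded_complex \<Rightarrow> bool" where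
  "multiplicity_upper_bound V \<Delta> F \<longleftrightarrow>
     (let n = card V; d = nat (complex_dim \<Delta> + 1) in
        real (face_number \<Delta> (int d - 1))
          \<le> 1 / fact (n - d) * (\<Prod>i = 1..n - d. real_of_int (max_shift F i)))"

end

theory Submission
  imports Defs "HOL-Library.Function_Algebras"
begin

text \<open>
  The mathematical content is one lower bound: in every graded free resolution of a Stanley-Reisner
  ring of codimension \<open>c\<close>, each module in homological degree \<open>1 \<le> i \<le> c\<close> has a generator of
  degree at least \<open>i + 1\<close> (\<open>exists_large_shift\<close>, \<open>max_shift_lower_bound\<close>).  In particular all the
  maximal shifts that occur in the products are defined and positive.

  Given this bound, write \<open>P k\<close> for the product of \<open>M\<^sub>i / i\<close> over \<open>1 \<le> i \<le> k\<close>, formed with the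
  maximal shifts of the resolution of the union, and let \<open>N\<close>, \<open>a\<close>, \<open>b\<close> be the numbers of vertices
  of the union and of the two complexes, each diminished by \<open>d\<close>.  The hypotheses bound the numbers of
  \<open>(d-1)\<close>-faces of the two complexes by \<open>P a\<close> and \<open>P b\<close>, and the claim is the bound \<open>P N\<close>
  for the union.  If only one of the complexes has dimension \<open>d - 1\<close>, or if one vertex set contains
  the other (the complexes being induced, one of them is then the union), monotonicity of \<open>P\<close> is
  enough.  Otherwise \<open>a, b < N\<close>, say \<open>b \<le> a\<close>, and the bound on the number of common vertices gives
  \<open>M\<^sub>N = N + t + 1 \<ge> a + b + 2\<close>.  Since \<open>M\<^sub>i \<ge> i + 1\<close> makes the quotients \<open>P k / (k + 1)\<close>
  increase with \<open>k\<close>, this yields \<open>P N \<ge> P a (a + b + 2) / (a + 1) \<ge> P a + P b\<close>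
  (\<open>prod_ratio_superadditive\<close>).

  For the lower bound on shifts let \<open>T\<^sub>i(B)\<close> be the homology in degree \<open>i\<close> of the resolution modulo the
  variables in \<open>B\<close>, that is, \<open>Tor\<^sub>i\<close> of the Stanley-Reisner ring with \<open>S/(x\<^sub>v : v \<in> B)\<close>.  Adding
  one variable to \<open>B\<close> relates these groups by a long exact sequence, which gives four facts.
  \<^item> \<open>T\<^sub>i(B) = 0\<close> for \<open>i > |B|\<close>.
  \<^item> \<open>T\<^sub>i(B)\<close> vanishes in degrees \<open>\<le> i\<close> for \<open>i \<ge> 1\<close>, since every vertex is a face and the ideal
    therefore contains no linear forms.
  \<^item> If \<open>T\<^sub>i(B \<union> {v}) = 0\<close> then \<open>T\<^sub>i(B) = 0\<close>, by Nakayama's lemma.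
  \<^item> If \<open>\<sigma>\<close> is a facet, the monomial \<open>x\<^sup>\<sigma>\<close> is nonzero in the Stanley-Reisner ring and is killed by
    all variables outside \<open>\<sigma>\<close>; connecting maps lift it to a nonzero class in \<open>T\<^sub>i(B)\<close> for every set
    \<open>B\<close> of \<open>i\<close> vertices outside \<open>\<sigma>\<close>.

  If all generators in homological degree \<open>i\<close> had degree \<open>\<le> i\<close>, then \<open>T\<^sub>i(V)\<close>, which lives in the degrees
  of these generators, would vanish by the second fact; by the third, \<open>T\<^sub>i(B) = 0\<close> for all \<open>B\<close>, which
  contradicts the fourth as long as \<open>i\<close> vertices outside a facet of maximal dimension exist.
\<close>


section \<open>The Stanley-Reisner ideal\<close>

lemma poly_ring_simps [simp]:
  "carrier (poly_ring V) = poly_carrier V"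
  "x \<otimes>\<^bsub>poly_ring V\<^esub> y = x * y"
  "x \<oplus>\<^bsub>poly_ring V\<^esub> y = x + y"
  "\<zero>\<^bsub>poly_ring V\<^esub> = 0"
  "\<one>\<^bsub>poly_ring V\<^esub> = 1"
  by (simp_all add: poly_ring_def)

lemma keys_add_nat: "Poly_Mapping.keys (a + b) = Poly_Mapping.keys a \<union> Poly_Mapping.keys (b :: 'v \<Rightarrow>\<^sub>0 nat)"
  by (auto simp: in_keys_iff lookup_add)

lemma keys_multE:
  assumes "m \<in> Poly_Mapping.keys (f * g)"
  obtains a b where "m = a + b" "a \<in> Poly_Mapping.keys f" "b \<in> Poly_Mapping.keys g"
  using keys_mult[of f g] assms by blast

lemma mono_degree_add: "mono_degree (a + b) = mono_degree a + mono_degree b"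
  unfolding mono_degree_def
  by (rule setsum_keys_plus_distrib) auto

lemma mono_degree_single [simp]: "mono_degree (Poly_Mapping.single v n) = n"
  by (simp add: mono_degree_def)

lemma card_keys_le_mono_degree: "card (Poly_Mapping.keys m) \<le> mono_degree m"
proof -
  have "card (Poly_Mapping.keys m) = (\<Sum>v\<in>Poly_Mapping.keys m. 1)" by simp
  also have "\<dots> \<le> mono_degree m" unfolding mono_degree_def
    by (rule sum_mono) (auto simp: in_keys_iff)
  finally show ?thesis .
qed

lemma mono_degree_pos: "mono_degree m > 0 \<Longrightarrow> Poly_Mapping.keys m \<noteq> {}"
  by (auto simp: mono_degree_def)

lemma poly_carrier_zero: "0 \<in> poly_carrier V"
  and poly_carrier_one: "1 \<in> poly_carrier V"
  by (auto simp: poly_carrier_def)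

lemma poly_carrier_add: "f \<in> poly_carrier V \<Longrightarrow> g \<in> poly_carrier V \<Longrightarrow> f + g \<in> poly_carrier V"
  unfolding poly_carrier_def using keys_add[of f g] by blast

lemma keys_uminus: "Poly_Mapping.keys (- f) = Poly_Mapping.keys (f :: 'a \<Rightarrow>\<^sub>0 'b::ab_group_add)"
  by (auto simp: in_keys_iff)

lemma poly_carrier_uminus: "f \<in> poly_carrier V \<Longrightarrow> - f \<in> poly_carrier V"
  by (simp add: poly_carrier_def keys_uminus)

lemma poly_carrier_mult: "f \<in> poly_carrier V \<Longrightarrow> g \<in> poly_carrier V \<Longrightarrow> f * g \<in> poly_carrier V"
  unfolding poly_carrier_def by (fastforce elim!: keys_multE simp: keys_add_nat)

lemma cring_poly_ring: "cring (poly_ring V :: ('v, 'k::field) mpoly ring)"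
proof (rule cringI)
  show "abelian_group (poly_ring V :: ('v, 'k) mpoly ring)"
  proof (rule abelian_groupI)
    fix x :: "('v, 'k) mpoly" assume "x \<in> carrier (poly_ring V)"
    then show "\<exists>y\<in>carrier (poly_ring V). y \<oplus>\<^bsub>poly_ring V\<^esub> x = \<zero>\<^bsub>poly_ring V\<^esub>"
      by (intro bexI[of _ "- x"]) (auto simp: poly_carrier_uminus)
  qed (auto simp: poly_carrier_add poly_carrier_zero ac_simps)
  show "Group.comm_monoid (poly_ring V :: ('v, 'k) mpoly ring)"
    by (rule comm_monoidI) (auto simp: poly_carrier_mult poly_carrier_one ac_simps)
qed (auto simp: distrib_right)

lemma face_subset: "simplicial_complex V \<Delta> \<Longrightarrow> \<sigma> \<in> \<Delta> \<Longrightarrow> \<tau> \<subseteq> \<sigma> \<Longrightarrow> \<tau> \<in> \<Delta>"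
  unfolding simplicial_complex_def by metis

definition nonface_supported :: "'v set \<Rightarrow> 'v set set \<Rightarrow> ('v, 'k::field) mpoly set" where
  "nonface_supported V \<Delta> = {f \<in> poly_carrier V. \<forall>m\<in>Poly_Mapping.keys f. Poly_Mapping.keys m \<notin> \<Delta>}"

text \<open>Multiplication enlarges the support of a monomial, and the non-faces are closed under supersets.\<close>

lemma ideal_nonface_supported:
  assumes "simplicial_complex V \<Delta>"
  shows "ideal (nonface_supported V \<Delta>) (poly_ring V :: ('v, 'k::field) mpoly ring)"
proof (rule idealI)
  interpret cring "poly_ring V :: ('v, 'k) mpoly ring" by (rule cring_poly_ring)
  show "ring (poly_ring V :: ('v, 'k) mpoly ring)" by (rule ring_axioms)
  have mult: "f * g \<in> nonface_supported V \<Delta>"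
    if "f \<in> nonface_supported V \<Delta>" "g \<in> poly_carrier V" for f g :: "('v, 'k) mpoly"
  proof -
    have "Poly_Mapping.keys m \<notin> \<Delta>" if m: "m \<in> Poly_Mapping.keys (f * g)" for m
    proof -
      obtain a b where ab: "m = a + b" "a \<in> Poly_Mapping.keys f"
        using m keys_mult[of f g] by blast
      then have "Poly_Mapping.keys a \<notin> \<Delta>"
        using \<open>f \<in> nonface_supported V \<Delta>\<close> by (simp add: nonface_supported_def)
      moreover have "Poly_Mapping.keys a \<subseteq> Poly_Mapping.keys m"
        unfolding ab(1) keys_add_nat by (rule Un_upper1)
      ultimately show ?thesis using face_subset[OF assms] by metis
    qed
    moreover have "f * g \<in> poly_carrier V"
      using that by (intro poly_carrier_mult) (simp_all add: nonface_supported_def)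
    ultimately show ?thesis by (simp add: nonface_supported_def)
  qed
  show "subgroup (nonface_supported V \<Delta>) (add_monoid (poly_ring V :: ('v, 'k) mpoly ring))"
  proof (rule group.subgroupI[OF a_group])
    fix f g :: "('v, 'k) mpoly" assume f: "f \<in> nonface_supported V \<Delta>"
    have "\<ominus>\<^bsub>poly_ring V\<^esub> f = - f"
      by (rule minus_equality) (use f in \<open>auto simp: nonface_supported_def poly_carrier_uminus\<close>)
    moreover have "- f \<in> nonface_supported V \<Delta>"
      using f by (auto simp: nonface_supported_def poly_carrier_uminus keys_uminus)
    ultimately show "inv\<^bsub>add_monoid (poly_ring V)\<^esub> f \<in> nonface_supported V \<Delta>"
      by (simp add: a_inv_def)
    assume "g \<in> nonface_supported V \<Delta>"
    then show "f \<otimes>\<^bsub>add_monoid (poly_ring V)\<^esub> g \<in> nonface_supported V \<Delta>"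
      using f keys_add[of f g] by (auto simp: nonface_supported_def poly_carrier_add)
  next
    show "nonface_supported V \<Delta> \<noteq> {}"
      using poly_carrier_zero by (force simp: nonface_supported_def)
  qed (auto simp: nonface_supported_def)
  fix a x :: "('v, 'k) mpoly"
  assume ax: "a \<in> nonface_supported V \<Delta>" "x \<in> carrier (poly_ring V)"
  then show "a \<otimes>\<^bsub>poly_ring V\<^esub> x \<in> nonface_supported V \<Delta>" using mult by simp
  show "x \<otimes>\<^bsub>poly_ring V\<^esub> a \<in> nonface_supported V \<Delta>"
    using mult[of a x] ax by (simp add: mult.commute)
qed

lemma prod_variable:
  assumes "finite \<sigma>"
  shows "(\<Prod>v\<in>\<sigma>. variable v :: ('v, 'k::field) mpoly)
    = Poly_Mapping.single (\<Sum>v\<in>\<sigma>. Poly_Mapping.single v 1) 1"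
  using assms by induction (simp_all add: variable_def mult_single)

lemma keys_sum_single:
  assumes "finite \<sigma>"
  shows "Poly_Mapping.keys (\<Sum>v\<in>\<sigma>. Poly_Mapping.single v (1::nat)) = \<sigma>"
  using assms by induction (simp_all add: keys_add_nat)

lemma keys_prod_variable:
  assumes "finite \<sigma>"
  shows "Poly_Mapping.keys (\<Prod>v\<in>\<sigma>. variable v :: ('v, 'k::field) mpoly)
    = {\<Sum>v\<in>\<sigma>. Poly_Mapping.single v 1}"
  by (simp add: prod_variable[OF assms])

lemma prod_variable_in_poly_carrier:
  assumes "finite \<sigma>" "\<sigma> \<subseteq> V"
  shows "(\<Prod>v\<in>\<sigma>. variable v :: ('v, 'k::field) mpoly) \<in> poly_carrier V"
  using assms by (simp add: poly_carrier_def keys_prod_variable keys_sum_single del: One_nat_def)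

lemma sr_generators_subset:
  assumes "simplicial_complex V \<Delta>"
  shows "{\<Prod>v\<in>\<sigma>. variable v |\<sigma>. \<sigma> \<subseteq> V \<and> \<sigma> \<notin> \<Delta>} \<subseteq> (nonface_supported V \<Delta> :: ('v, 'k::field) mpoly set)"
proof -
  have "finite \<sigma>" if "\<sigma> \<subseteq> V" for \<sigma>
    using that assms finite_subset by (auto simp: simplicial_complex_def)
  then show ?thesis
    by (auto simp: nonface_supported_def prod_variable_in_poly_carrier keys_prod_variable keys_sum_single
        simp del: One_nat_def)
qed

text \<open>Connects exactness of a resolution at its last module, phrased with the kernel of the
  projection, to the ideal itself.\<close>

lemma kernel_sr_proj:
  assumes "simplicial_complex V \<Delta>"
  shows "a_kernel (poly_ring V) (sr_ring V \<Delta>) (sr_proj V \<Delta>)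
    = (sr_ideal V \<Delta> :: ('v, 'k::field) mpoly set)"
proof -
  interpret R: cring "poly_ring V :: ('v, 'k) mpoly ring" by (rule cring_poly_ring)
  have "nonface_supported V \<Delta> \<subseteq> carrier (poly_ring V)" by (auto simp: nonface_supported_def)
  then have I: "ideal (sr_ideal V \<Delta>) (poly_ring V :: ('v, 'k) mpoly ring)"
    unfolding sr_ideal_def using sr_generators_subset[OF assms]
    by (intro R.genideal_ideal) blast
  interpret I: ideal "sr_ideal V \<Delta>" "poly_ring V :: ('v, 'k) mpoly ring" by (rule I)
  show ?thesis
    unfolding a_kernel_def' sr_ring_def sr_proj_def FactRing_def
    using ideal.rcos_const_imp_mem[OF I] I.a_rcos_const I.Icarr by auto
qed

lemma kernel_sr_proj_subset:
  assumes "simplicial_complex V \<Delta>"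
  shows "a_kernel (poly_ring V) (sr_ring V \<Delta>) (sr_proj V \<Delta>)
    \<subseteq> (nonface_supported V \<Delta> :: ('v, 'k::field) mpoly set)"
  unfolding kernel_sr_proj[OF assms] sr_ideal_def
  using ring.genideal_minimal[OF cring.axioms(1)[OF cring_poly_ring]
      ideal_nonface_supported[OF assms] sr_generators_subset[OF assms]] .

lemma nonface_monomial_in_kernel:
  assumes "simplicial_complex V \<Delta>" "\<sigma> \<subseteq> V" "\<sigma> \<notin> \<Delta>"
  shows "(\<Prod>v\<in>\<sigma>. variable v :: ('v, 'k::field) mpoly)
    \<in> a_kernel (poly_ring V) (sr_ring V \<Delta>) (sr_proj V \<Delta>)"
proof -
  have "nonface_supported V \<Delta> \<subseteq> carrier (poly_ring V :: ('v, 'k) mpoly ring)"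
    by (auto simp: nonface_supported_def)
  then have "{\<Prod>v\<in>\<sigma>. variable v |\<sigma>. \<sigma> \<subseteq> V \<and> \<sigma> \<notin> \<Delta>} \<subseteq> (sr_ideal V \<Delta> :: ('v, 'k) mpoly set)"
    unfolding sr_ideal_def using sr_generators_subset[OF assms(1)]
    by (intro ring.genideal_self[OF cring.axioms(1)[OF cring_poly_ring]]) blast
  then show ?thesis
    unfolding kernel_sr_proj[OF assms(1)] using assms(2,3) by blast
qed

section \<open>Homogeneous components and multiples of variables\<close>

lemma homogeneous_part_zero: "0 \<in> homogeneous_part V j"
  by (simp add: homogeneous_part_def poly_carrier_zero)

lemma homogeneous_part_add:
  "f \<in> homogeneous_part V j \<Longrightarrow> g \<in> homogeneous_part V j \<Longrightarrow> f + g \<in> homogeneous_part V j"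
  unfolding homogeneous_part_def using keys_add[of f g] poly_carrier_add by blast

lemma homogeneous_part_diff:
  assumes "f \<in> homogeneous_part V j" "g \<in> homogeneous_part V j"
  shows "f - g \<in> homogeneous_part V j"
proof -
  have "- g \<in> homogeneous_part V j"
    using assms(2) by (simp add: homogeneous_part_def keys_uminus poly_carrier_uminus)
  from homogeneous_part_add[OF assms(1) this] show ?thesis by simp
qed

lemma homogeneous_part_sum:
  "(\<And>q. q \<in> A \<Longrightarrow> f q \<in> homogeneous_part V j) \<Longrightarrow> sum f A \<in> homogeneous_part V j"
  by (induction A rule: infinite_finite_induct) (auto simp: homogeneous_part_zero homogeneous_part_add)

lemma homogeneous_part_mult:
  "f \<in> homogeneous_part V j \<Longrightarrow> g \<in> homogeneous_part V k \<Longrightarrow> f * g \<in> homogeneous_part V (j + k)"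
  unfolding homogeneous_part_def
  by (auto intro: poly_carrier_mult elim!: keys_multE simp: mono_degree_add)

lemma homogeneous_part_neg: "j < 0 \<Longrightarrow> f \<in> homogeneous_part V j \<Longrightarrow> f = 0"
  unfolding homogeneous_part_def by (cases "f = 0") (force simp flip: keys_eq_empty)+

lemma variable_homogeneous: "v \<in> V \<Longrightarrow> variable v \<in> homogeneous_part V 1"
  by (auto simp: homogeneous_part_def poly_carrier_def variable_def mono_degree_def)

definition homogeneous_component :: "int \<Rightarrow> ('v, 'k::field) mpoly \<Rightarrow> ('v, 'k) mpoly" where
  "homogeneous_component j f = Poly_Mapping.mapp (\<lambda>m c. c when int (mono_degree m) = j) f"

lemma lookup_homogeneous_component:
  "Poly_Mapping.lookup (homogeneous_component j f) m
    = (Poly_Mapping.lookup f m when int (mono_degree m) = j)"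
  by (auto simp: homogeneous_component_def lookup_mapp in_keys_iff when_def)

lemma keys_homogeneous_component:
  "Poly_Mapping.keys (homogeneous_component j f) = {m \<in> Poly_Mapping.keys f. int (mono_degree m) = j}"
  by (simp add: set_eq_iff in_keys_iff lookup_homogeneous_component when_def)

lemma homogeneous_component_mem: "f \<in> poly_carrier V \<Longrightarrow> homogeneous_component j f \<in> homogeneous_part V j"
  by (auto simp: homogeneous_part_def poly_carrier_def keys_homogeneous_component)

lemma homogeneous_component_id: "f \<in> homogeneous_part V j \<Longrightarrow> homogeneous_component j f = f"
  by (rule poly_mapping_eqI)
    (auto simp: lookup_homogeneous_component homogeneous_part_def when_def in_keys_iff)

lemma homogeneous_component_add:
  "homogeneous_component j (f + g) = homogeneous_component j f + homogeneous_component j g"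
  by (rule poly_mapping_eqI) (simp add: lookup_homogeneous_component lookup_add when_add_distrib)

lemma homogeneous_component_sum:
  "homogeneous_component j (sum f A) = (\<Sum>q\<in>A. homogeneous_component j (f q))"
proof -
  have "homogeneous_component j 0 = 0"
    by (rule poly_mapping_eqI) (simp add: lookup_homogeneous_component)
  then show ?thesis
    by (induction A rule: infinite_finite_induct) (simp_all add: homogeneous_component_add)
qed

text \<open>Multiplication by a homogeneous polynomial shifts degrees, so it commutes with taking components.
  This is what allows preimages under a graded matrix to be chosen homogeneous.\<close>

lemma homogeneous_component_mult:
  assumes "a \<in> homogeneous_part V j"
  shows "homogeneous_component (j + k) (a * f) = a * homogeneous_component k f"
proof -
  define r where "r = f - homogeneous_component k f"
  have r: "int (mono_degree m) \<noteq> k" if "m \<in> Poly_Mapping.keys r" for m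
    using that by (auto simp: r_def in_keys_iff lookup_minus lookup_homogeneous_component)
  have "Poly_Mapping.keys (homogeneous_component (j + k) (a * r)) = {}"
    unfolding keys_homogeneous_component using assms r
    by (force simp: homogeneous_part_def mono_degree_add elim!: keys_multE)
  then have 0: "homogeneous_component (j + k) (a * r) = 0" by simp
  have deg: "homogeneous_component (j + k) (a * homogeneous_component k f) = a * homogeneous_component k f"
  proof (rule poly_mapping_eqI)
    fix m
    have "int (mono_degree m) = j + k" if "m \<in> Poly_Mapping.keys (a * homogeneous_component k f)"
      using that assms
      by (auto simp: homogeneous_part_def mono_degree_add keys_homogeneous_component elim!: keys_multE)
    then show "Poly_Mapping.lookup (homogeneous_component (j + k) (a * homogeneous_component k f)) m
        = Poly_Mapping.lookup (a * homogeneous_component k f) m"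
      by (auto simp: lookup_homogeneous_component when_def in_keys_iff)
  qed
  have "a * f = a * homogeneous_component k f + a * r" by (simp add: r_def algebra_simps)
  then show ?thesis by (simp add: homogeneous_component_add 0 deg)
qed

text \<open>The ideal \<open>(x\<^sub>v : v \<in> B)\<close>, described by its monomials: each must meet \<open>B\<close>.\<close>

definition meeting :: "'v set \<Rightarrow> ('v, 'k::field) mpoly set" where
  "meeting B = {f. \<forall>m\<in>Poly_Mapping.keys f. Poly_Mapping.keys m \<inter> B \<noteq> {}}"

lemma meeting_zero: "0 \<in> meeting B"
  by (simp add: meeting_def)

lemma meeting_add: "f \<in> meeting B \<Longrightarrow> g \<in> meeting B \<Longrightarrow> f + g \<in> meeting B"
  unfolding meeting_def using keys_add[of f g] by blast

lemma meeting_diff: "f \<in> meeting B \<Longrightarrow> g \<in> meeting B \<Longrightarrow> f - g \<in> meeting B"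
  using meeting_add[of f B "- g"] by (simp add: meeting_def keys_uminus)

lemma meeting_sum: "(\<And>q. q \<in> A \<Longrightarrow> f q \<in> meeting B) \<Longrightarrow> sum f A \<in> meeting B"
  by (induction A rule: infinite_finite_induct) (auto simp: meeting_zero meeting_add)

lemma meeting_mult: "f \<in> meeting B \<Longrightarrow> a * f \<in> meeting B"
  unfolding meeting_def by (auto elim!: keys_multE simp: keys_add_nat Int_Un_distrib2)

lemma meeting_empty: "meeting {} = {0}"
  by (auto simp: meeting_def simp flip: keys_eq_empty)

lemma lookup_single_mult:
  fixes f :: "('v, 'k::field) mpoly"
  shows "Poly_Mapping.lookup (Poly_Mapping.single a 1 * f) (a + m) = Poly_Mapping.lookup f m"
proof -
  have "Poly_Mapping.lookup (Poly_Mapping.single a 1 * f) (a + m)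
      = (\<Sum>l. (\<Sum>q. Poly_Mapping.lookup f q when a + m = l + q) when a = l)"
    by (simp add: lookup_mult lookup_single when_mult)
  also have "\<dots> = Poly_Mapping.lookup f m" by simp
  finally show ?thesis .
qed

lemma keys_variable_mult:
  "Poly_Mapping.keys (variable v * f) = (+) (Poly_Mapping.single v 1) ` Poly_Mapping.keys f"
proof
  show "Poly_Mapping.keys (variable v * f) \<subseteq> (+) (Poly_Mapping.single v 1) ` Poly_Mapping.keys f"
    by (auto elim!: keys_multE simp: variable_def)
  show "(+) (Poly_Mapping.single v 1) ` Poly_Mapping.keys f \<subseteq> Poly_Mapping.keys (variable v * f)"
    using lookup_single_mult[of "Poly_Mapping.single v 1" f]
    by (auto simp: variable_def in_keys_iff)
qed

lemma variable_mult_meeting: "v \<in> B \<Longrightarrow> variable v * f \<in> meeting B"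
  by (auto simp: meeting_def keys_variable_mult keys_add_nat)

text \<open>A variable outside \<open>B\<close> is a nonzerodivisor modulo \<open>(x\<^sub>v : v \<in> B)\<close>.\<close>

lemma meeting_cancel: "v \<notin> B \<Longrightarrow> variable v * f \<in> meeting B \<Longrightarrow> f \<in> meeting B"
  by (auto simp: meeting_def keys_variable_mult keys_add_nat Int_Un_distrib2)

text \<open>The witness collects the monomials divisible by \<open>x\<^sub>v\<close>, divided by \<open>x\<^sub>v\<close>; what is left over avoids
  \<open>x\<^sub>v\<close> and must meet \<open>B\<close>.\<close>

lemma meeting_insert:
  assumes f: "f \<in> homogeneous_part V j" "f \<in> meeting (insert v B)"
  shows "\<exists>g\<in>homogeneous_part V (j - 1). f - variable v * g \<in> meeting B"
proof -
  let ?e = "Poly_Mapping.single v (1::nat)"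
  define g where "g = Poly_Mapping.map_key ((+) ?e) f"
  have inj: "inj ((+) ?e)" by simp
  have keys_g: "Poly_Mapping.keys g = {m. ?e + m \<in> Poly_Mapping.keys f}"
    unfolding g_def keys_map_key[OF inj] by auto
  have "int (mono_degree m) = j - 1 \<and> Poly_Mapping.keys m \<subseteq> V" if "m \<in> Poly_Mapping.keys g" for m
  proof -
    have "?e + m \<in> Poly_Mapping.keys f" using that keys_g by simp
    then have "int (mono_degree (?e + m)) = j" "Poly_Mapping.keys (?e + m) \<subseteq> V"
      using f(1) by (auto simp: homogeneous_part_def poly_carrier_def)
    then show ?thesis by (simp add: mono_degree_add keys_add_nat)
  qed
  then have "g \<in> homogeneous_part V (j - 1)"
    by (simp add: homogeneous_part_def poly_carrier_def)
  moreover have "f - variable v * g \<in> meeting B"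
    unfolding meeting_def
  proof (intro CollectI ballI)
    fix m assume m: "m \<in> Poly_Mapping.keys (f - variable v * g)"
    have "v \<notin> Poly_Mapping.keys m"
    proof
      assume "v \<in> Poly_Mapping.keys m"
      then have "m = ?e + (m - ?e)"
        by (intro poly_mapping_eqI) (auto simp: lookup_add lookup_minus lookup_single in_keys_iff when_def)
      then obtain n where n: "m = ?e + n" by blast
      have "Poly_Mapping.lookup (variable v * g) m = Poly_Mapping.lookup g n"
        unfolding n variable_def by (rule lookup_single_mult)
      also have "\<dots> = Poly_Mapping.lookup f m"
        unfolding g_def n map_key.rep_eq[OF inj] by simp
      finally show False using m by (simp add: in_keys_iff lookup_minus)
    qed
    moreover from this have "m \<notin> Poly_Mapping.keys (variable v * g)"
      by (auto simp: keys_variable_mult keys_add_nat)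
    then have "m \<in> Poly_Mapping.keys f" using m by (simp add: in_keys_iff lookup_minus)
    ultimately show "Poly_Mapping.keys m \<inter> B \<noteq> {}" using f(2) by (auto simp: meeting_def)
  qed
  ultimately show ?thesis by blast
qed

section \<open>Graded resolutions modulo sets of variables\<close>

text \<open>An abstract form of a graded free resolution: \<open>M i j\<close> is the part of degree \<open>j\<close> of the \<open>i\<close>-th
  module, \<open>D i\<close> the map leaving that module, \<open>X v\<close> multiplication by the variable \<open>x\<^sub>v\<close>, and \<open>N B\<close> the
  vectors with entries in \<open>(x\<^sub>v : v \<in> B)\<close>.  The last two axioms, with \<open>N_empty\<close>, say that the
  variables form a regular sequence on the free modules.  Keeping \<open>N B\<close> as a subgroup makes it
  possible to speak about the reduction modulo \<open>B\<close> without forming quotient rings or modules.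

  The map \<open>D 0\<close> is zero rather than the augmentation, so that \<open>M 0\<close> modulo the image of \<open>D 1\<close>
  is the module being resolved.\<close>

locale graded_resolution =
  fixes V :: "'v set"
    and M :: "nat \<Rightarrow> int \<Rightarrow> 'm::ab_group_add set"
    and D :: "nat \<Rightarrow> 'm \<Rightarrow> 'm"
    and X :: "'v \<Rightarrow> 'm \<Rightarrow> 'm"
    and N :: "'v set \<Rightarrow> 'm set"
  assumes M_zero: "0 \<in> M i j"
    and M_diff: "u \<in> M i j \<Longrightarrow> w \<in> M i j \<Longrightarrow> u - w \<in> M i j"
    and M_bounded_below: "\<exists>l. \<forall>j<l. M i j \<subseteq> {0}"
    and D_0: "D 0 u = 0"
    and D_diff: "D i (u - w) = D i u - D i w"
    and D_mem: "u \<in> M (Suc i) j \<Longrightarrow> D (Suc i) u \<in> M i j"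
    and D_D: "u \<in> M (Suc i) j \<Longrightarrow> D i (D (Suc i) u) = 0"
    and exact: "u \<in> M (Suc i) j \<Longrightarrow> D (Suc i) u = 0
      \<Longrightarrow> \<exists>z\<in>M (Suc (Suc i)) j. D (Suc (Suc i)) z = u"
    and X_diff: "X v (u - w) = X v u - X v w"
    and X_commute: "X v (X x u) = X x (X v u)"
    and X_mem: "v \<in> V \<Longrightarrow> u \<in> M i j \<Longrightarrow> X v u \<in> M i (j + 1)"
    and D_X: "D i (X v u) = X v (D i u)"
    and N_zero: "0 \<in> N B"
    and N_diff: "u \<in> N B \<Longrightarrow> w \<in> N B \<Longrightarrow> u - w \<in> N B"
    and N_empty: "N {} = {0}"
    and N_mono: "B \<subseteq> C \<Longrightarrow> N B \<subseteq> N C"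
    and D_N: "u \<in> N B \<Longrightarrow> D i u \<in> N B"
    and X_N: "u \<in> N B \<Longrightarrow> X v u \<in> N B"
    and X_in_N: "v \<in> B \<Longrightarrow> X v u \<in> N B"
    and N_cancel: "v \<notin> B \<Longrightarrow> X v u \<in> N B \<Longrightarrow> u \<in> N B"
    and N_insert: "v \<in> V \<Longrightarrow> u \<in> M i j \<Longrightarrow> u \<in> N (insert v B)
      \<Longrightarrow> \<exists>y\<in>M i (j - 1). u - X v y \<in> N B"
begin

lemma M_add: "u \<in> M i j \<Longrightarrow> w \<in> M i j \<Longrightarrow> u + w \<in> M i j"
  using M_diff[of u i j "0 - w"] M_diff[OF M_zero, of w i j] by simp

lemma N_add: "u \<in> N B \<Longrightarrow> w \<in> N B \<Longrightarrow> u + w \<in> N B"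
  using N_diff[of u B "0 - w"] N_diff[OF N_zero, of w B] by simp

lemma X_mem': "v \<in> V \<Longrightarrow> u \<in> M i (j - 1) \<Longrightarrow> X v u \<in> M i j"
  using X_mem[of v u i "j - 1"] by simp

lemma D_zero: "D i 0 = 0"
  using D_diff[of i 0 0] by simp

lemma D_add: "D i (u + w) = D i u + D i w"
  using D_diff[of i u "0 - w"] D_diff[of i 0 w] by (simp add: D_zero)

text \<open>The homology of the complex modulo the variables in \<open>B\<close> vanishes at the \<open>i\<close>-th module in degree
  \<open>j\<close>; for a resolution this is the vanishing of \<open>Tor\<^sub>i\<close> with \<open>S/(x\<^sub>v : v \<in> B)\<close> in degree \<open>j\<close>.\<close>

definition acyclic_mod :: "'v set \<Rightarrow> nat \<Rightarrow> int \<Rightarrow> bool" where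
  "acyclic_mod B i j \<longleftrightarrow>
     (\<forall>u\<in>M i j. D i u \<in> N B \<longrightarrow> (\<exists>z\<in>M (Suc i) j. u - D (Suc i) z \<in> N B))"

lemma acyclic_mod_empty: "acyclic_mod {} (Suc i) j"
  unfolding acyclic_mod_def N_empty by (metis exact eq_iff_diff_eq_0 singletonD singletonI)

text \<open>The part \<open>T\<^sub>i\<^sub>+\<^sub>1(B) \<rightarrow> T\<^sub>i\<^sub>+\<^sub>1(B \<union> {v}) \<rightarrow> T\<^sub>i(B)(-1)\<close> of the long exact sequence that multiplication
  by \<open>x\<^sub>v\<close> induces: if both outer terms vanish, so does the middle one.\<close>

lemma acyclic_mod_insert:
  assumes v: "v \<in> V" "v \<notin> B"
    and ac: "acyclic_mod B i (j - 1)" "acyclic_mod B (Suc i) j"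
  shows "acyclic_mod (insert v B) (Suc i) j"
  unfolding acyclic_mod_def
proof (intro ballI impI)
  fix u assume u: "u \<in> M (Suc i) j" and Du: "D (Suc i) u \<in> N (insert v B)"
  obtain y where y: "y \<in> M i (j - 1)" and Dy: "D (Suc i) u - X v y \<in> N B"
    using N_insert[OF v(1) D_mem[OF u] Du] by blast
  have "X v (D i y) \<in> N B"
    using N_diff[OF N_zero D_N[OF Dy, of i]] by (simp add: D_diff D_X D_D[OF u])
  then have "D i y \<in> N B" by (rule N_cancel[OF v(2)])
  then obtain z where z: "z \<in> M (Suc i) (j - 1)" and yz: "y - D (Suc i) z \<in> N B"
    using ac(1) y unfolding acyclic_mod_def by blast
  have "D (Suc i) (u - X v z) = (D (Suc i) u - X v y) + X v (y - D (Suc i) z)"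
    by (simp add: D_diff D_X X_diff)
  also have "\<dots> \<in> N B" by (intro N_add Dy X_N yz)
  finally have "D (Suc i) (u - X v z) \<in> N B" .
  moreover have "u - X v z \<in> M (Suc i) j" by (intro M_diff u X_mem' v z)
  ultimately obtain t where t: "t \<in> M (Suc (Suc i)) j"
    and ut: "u - X v z - D (Suc (Suc i)) t \<in> N B"
    using ac(2) unfolding acyclic_mod_def by blast
  have "u - D (Suc (Suc i)) t = (u - X v z - D (Suc (Suc i)) t) + X v z" by simp
  also have "\<dots> \<in> N (insert v B)"
    using ut N_mono[of B "insert v B"] by (intro N_add X_in_N) auto
  finally show "\<exists>z\<in>M (Suc (Suc i)) j. u - D (Suc (Suc i)) z \<in> N (insert v B)"
    using t by blast
qed

text \<open>Each added variable raises the length of the homology by at most one, as for a Koszul complex.\<close>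

lemma acyclic_mod_above_card:
  assumes "finite B" "B \<subseteq> V" "card B < i"
  shows "acyclic_mod B i j"
  using assms
proof (induction B arbitrary: i j rule: finite_induct)
  case empty
  then show ?case using acyclic_mod_empty by (cases i) auto
next
  case (insert v B)
  then obtain k where k: "i = Suc k" by (cases i) auto
  show ?case unfolding k
    by (rule acyclic_mod_insert) (use insert k in auto)
qed

text \<open>In the long exact sequence both the homological and the internal degree drop by one, so vanishing
  on and below the diagonal propagates from the first module to all later ones.\<close>

lemma acyclic_mod_below_diagonal:
  assumes start: "\<And>B j. B \<subseteq> V \<Longrightarrow> j \<le> 1 \<Longrightarrow> acyclic_mod B 1 j"
    and "finite B" "B \<subseteq> V" "j \<le> int i" "i > 0"
  shows "acyclic_mod B i j"
  using assms(2-)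
proof (induction B arbitrary: i j rule: finite_induct)
  case empty
  then show ?case using acyclic_mod_empty by (cases i) auto
next
  case (insert v B)
  then obtain k where k: "i = Suc k" by (cases i) auto
  show ?case
  proof (cases "k = 0")
    case True
    then show ?thesis using start[of "insert v B" j] insert k by simp
  next
    case False
    show ?thesis unfolding k
      by (rule acyclic_mod_insert) (use insert k False in auto)
  qed
qed

text \<open>Nakayama's lemma.  If the homology modulo \<open>B \<union> {v}\<close> vanishes, then \<open>x\<^sub>v\<close> acts surjectively on the
  homology modulo \<open>B\<close>; as \<open>x\<^sub>v\<close> raises degrees and the homology is bounded below, induction on the
  degree shows that it is zero.\<close>

lemma acyclic_mod_of_insert:
  assumes v: "v \<in> V" "v \<notin> B"
    and ac: "\<And>j. acyclic_mod (insert v B) i j"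
  shows "acyclic_mod B i j"
proof -
  obtain l where l: "\<forall>j<l. M i j \<subseteq> {0}" using M_bounded_below by blast
  (* induction upwards from degree l - 1, where the module is still zero *)
  have "acyclic_mod B i (l + int k - 1)" for k
  proof (induction k)
    case 0
    show ?case unfolding acyclic_mod_def
    proof (intro ballI impI)
      fix u assume "u \<in> M i (l + int 0 - 1)"
      then have "u = 0" using l[rule_format, of "l - 1"] by auto
      then show "\<exists>z\<in>M (Suc i) (l + int 0 - 1). u - D (Suc i) z \<in> N B"
        using D_zero N_zero M_zero by (metis diff_zero)
    qed
  next
    case (Suc k)
    let ?j = "l + int (Suc k) - 1"
    show ?case unfolding acyclic_mod_def
    proof (intro ballI impI)
      fix u assume u: "u \<in> M i ?j" and Du: "D i u \<in> N B"
      have "D i u \<in> N (insert v B)" using Du N_mono[of B "insert v B"] by auto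
      then obtain z where z: "z \<in> M (Suc i) ?j" and uz: "u - D (Suc i) z \<in> N (insert v B)"
        using ac[of ?j] u unfolding acyclic_mod_def by blast
      have "u - D (Suc i) z \<in> M i ?j" by (intro M_diff u D_mem z)
      then obtain y where y: "y \<in> M i (?j - 1)" and w: "u - D (Suc i) z - X v y \<in> N B"
        using N_insert[OF v(1) _ uz] by blast
      have "X v (D i y) = D i u - D i (u - D (Suc i) z - X v y)"
        by (simp add: D_diff D_X D_D[OF z])
      also have "\<dots> \<in> N B" by (intro N_diff Du D_N w)
      finally have "D i y \<in> N B" by (rule N_cancel[OF v(2)])
      moreover have "?j - 1 = l + int k - 1" by simp
      ultimately obtain t where t: "t \<in> M (Suc i) (?j - 1)" and yt: "y - D (Suc i) t \<in> N B"
        using Suc.IH y unfolding acyclic_mod_def by metis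
      have "u - D (Suc i) (z + X v t) = (u - D (Suc i) z - X v y) + X v (y - D (Suc i) t)"
        by (simp add: D_add D_X X_diff)
      also have "\<dots> \<in> N B" by (intro N_add w X_N yt)
      finally show "\<exists>z\<in>M (Suc i) ?j. u - D (Suc i) z \<in> N B"
        using M_add[OF z X_mem'[OF v(1) t]] by blast
    qed
  qed note bounded = this
  show ?thesis
  proof (cases "j < l")
    case True
    have "acyclic_mod B i j" if "M i j \<subseteq> {0}"
      unfolding acyclic_mod_def
      using that D_zero N_zero M_zero by (metis diff_zero singletonD subsetD)
    then show ?thesis using l True by blast
  next
    case False
    then show ?thesis using bounded[of "nat (j - l + 1)"] by simp
  qed
qed

lemma acyclic_mod_of_all_variables:
  assumes "finite V" "B \<subseteq> V" and ac: "\<And>j. acyclic_mod V i j"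
  shows "acyclic_mod B i j"
proof -
  have "acyclic_mod (V - C) i j" if "finite C" "C \<subseteq> V" for C j
    using that
  proof (induction C arbitrary: j rule: finite_induct)
    case empty
    then show ?case using ac by simp
  next
    case (insert v C)
    have "insert v (V - insert v C) = V - C" using insert by auto
    then show ?case
      using acyclic_mod_of_insert[of v "V - insert v C"] insert by auto
  qed
  from this[of "V - B" j] show ?thesis
    using assms by (simp add: double_diff finite_subset)
qed

text \<open>Suppose that the class of \<open>u0\<close> in the resolved module is nonzero and is killed by all variables in
  \<open>A\<close>.  One connecting map after the other lifts it to nonzero classes of homological degree \<open>|B|\<close>
  modulo \<open>B\<close>.  For the induction the lifted class must again be killed by all variables in \<open>A\<close>; this
  holds because the homology modulo \<open>B\<close> above degree \<open>|B|\<close> is zero.\<close>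

lemma not_acyclic_mod:
  assumes "finite V" "B \<subseteq> A" "A \<subseteq> V"
    and u0: "u0 \<in> M 0 j0" "\<And>z. z \<in> M 1 j0 \<Longrightarrow> D 1 z \<noteq> u0"
    and ann: "\<And>v. v \<in> A \<Longrightarrow> \<exists>z\<in>M 1 (j0 + 1). D 1 z = X v u0"
  shows "\<exists>j. \<not> acyclic_mod B (card B) j"
proof -
  have "\<exists>j. \<exists>u\<in>M (card B) j. D (card B) u \<in> N B
      \<and> (\<forall>z\<in>M (Suc (card B)) j. u - D (Suc (card B)) z \<notin> N B)
      \<and> (\<forall>v\<in>A. \<exists>z\<in>M (Suc (card B)) (j + 1). X v u - D (Suc (card B)) z \<in> N B)"
    using finite_subset[OF assms(2) finite_subset[OF assms(3,1)]] assms(2)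
  proof (induction B rule: finite_induct)
    case empty
    have "D 0 u0 \<in> N {}" using N_zero D_0 by simp
    moreover have "\<forall>z\<in>M 1 j0. u0 - D 1 z \<notin> N {}" using u0 N_empty by auto
    moreover have "\<forall>v\<in>A. \<exists>z\<in>M 1 (j0 + 1). X v u0 - D 1 z \<in> N {}"
      using ann N_empty by fastforce
    ultimately show ?case using u0(1) by auto
  next
    case (insert x B)
    let ?k = "card B"
    have xV: "x \<in> V" and BV: "B \<subseteq> V" and xA: "x \<in> A" using insert assms by auto
    obtain j u where u: "u \<in> M ?k j"
      and nb: "\<And>z. z \<in> M (Suc ?k) j \<Longrightarrow> u - D (Suc ?k) z \<notin> N B"
      and an: "\<And>v. v \<in> A \<Longrightarrow> \<exists>z\<in>M (Suc ?k) (j + 1). X v u - D (Suc ?k) z \<in> N B"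
      using insert by auto
    obtain w where w: "w \<in> M (Suc ?k) (j + 1)" and xw: "X x u - D (Suc ?k) w \<in> N B"
      using an[OF xA] by blast
    have sub: "N B \<subseteq> N (insert x B)" by (rule N_mono) auto
    have "D (Suc ?k) w = X x u - (X x u - D (Suc ?k) w)" by simp
    also have "\<dots> \<in> N (insert x B)"
      by (rule N_diff[OF X_in_N subsetD[OF sub xw]]) simp
    finally have c1: "D (Suc ?k) w \<in> N (insert x B)" .
    (* if w = D z + x y modulo B, then x u = x (D y) modulo B, and cancelling x makes u a boundary *)
    have c2: "w - D (Suc (Suc ?k)) z \<notin> N (insert x B)" if z: "z \<in> M (Suc (Suc ?k)) (j + 1)" for z
    proof
      assume asm: "w - D (Suc (Suc ?k)) z \<in> N (insert x B)"
      obtain y where y: "y \<in> M (Suc ?k) (j + 1 - 1)"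
        and b: "w - D (Suc (Suc ?k)) z - X x y \<in> N B"
        using N_insert[OF xV M_diff[OF w D_mem[OF z]] asm] by blast
      have "X x (u - D (Suc ?k) y)
          = (X x u - D (Suc ?k) w) + D (Suc ?k) (w - D (Suc (Suc ?k)) z - X x y)"
        by (simp add: D_diff D_X X_diff D_D[OF z])
      also have "\<dots> \<in> N B" by (intro N_add xw D_N b)
      finally have "u - D (Suc ?k) y \<in> N B" by (rule N_cancel[OF insert.hyps(2)])
      then show False using nb[of y] y by simp
    qed
    (* modulo B, both v w and x s have boundary v x u, so they differ by a boundary *)
    have c3: "\<exists>z\<in>M (Suc (Suc ?k)) (j + 1 + 1). X v w - D (Suc (Suc ?k)) z \<in> N (insert x B)"
      if v: "v \<in> A" for v
    proof -
      obtain s where s: "s \<in> M (Suc ?k) (j + 1)" and vs: "X v u - D (Suc ?k) s \<in> N B"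
        using an[OF v] by blast
      have vV: "v \<in> V" using v assms by auto
      have "D (Suc ?k) (X v w - X x s)
          = X x (X v u - D (Suc ?k) s) - X v (X x u - D (Suc ?k) w)"
        by (simp add: D_diff D_X X_diff X_commute[of v x])
      also have "\<dots> \<in> N B" by (intro N_diff X_N vs xw)
      finally have "D (Suc ?k) (X v w - X x s) \<in> N B" .
      moreover have "X v w - X x s \<in> M (Suc ?k) (j + 1 + 1)"
        by (intro M_diff X_mem vV xV w s)
      ultimately obtain z where z: "z \<in> M (Suc (Suc ?k)) (j + 1 + 1)"
        and e: "X v w - X x s - D (Suc (Suc ?k)) z \<in> N B"
        using acyclic_mod_above_card[OF insert.hyps(1) BV, of "Suc ?k" "j + 1 + 1"]
        unfolding acyclic_mod_def by auto
      have "X v w - D (Suc (Suc ?k)) z = (X v w - X x s - D (Suc (Suc ?k)) z) + X x s" by simp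
      also have "\<dots> \<in> N (insert x B)" using e sub by (intro N_add X_in_N) auto
      finally show ?thesis using z by blast
    qed
    have card: "card (insert x B) = Suc ?k" using insert.hyps by simp
    show ?case unfolding card
      by (intro exI[of _ "j + 1"] bexI[of _ w] conjI ballI c1 c2 c3 w)
  qed
  then show ?thesis unfolding acyclic_mod_def by blast
qed

end

section \<open>Resolutions of Stanley-Reisner rings\<close>

text \<open>Vectors are encoded as functions on the natural numbers that vanish beyond the rank, so that all
  modules of a resolution share one additive group.\<close>

definition free_part :: "'v set \<Rightarrow> ('v, 'k::field) mpoly graded_complex \<Rightarrow> nat \<Rightarrow> int
    \<Rightarrow> (nat \<Rightarrow> ('v, 'k) mpoly) set" where
  "free_part V F i j = {u. \<forall>p. if p < frank F i
     then u p \<in> homogeneous_part V (j - shifts F i ! p) else u p = 0}"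

definition boundary_map :: "('v, 'k::field) mpoly graded_complex \<Rightarrow> nat
    \<Rightarrow> (nat \<Rightarrow> ('v, 'k) mpoly) \<Rightarrow> nat \<Rightarrow> ('v, 'k) mpoly" where
  "boundary_map F i u = (case i of 0 \<Rightarrow> (\<lambda>p. 0) | Suc k \<Rightarrow>
     (\<lambda>p. if p < frank F k then \<Sum>q<frank F (Suc k). boundary F (Suc k) $$ (p, q) * u q else 0))"

definition variable_map :: "'v \<Rightarrow> (nat \<Rightarrow> ('v, 'k::field) mpoly) \<Rightarrow> nat \<Rightarrow> ('v, 'k) mpoly" where
  "variable_map v u = (\<lambda>p. variable v * u p)"

definition meeting_vectors :: "'v set \<Rightarrow> (nat \<Rightarrow> ('v, 'k::field) mpoly) set" where
  "meeting_vectors B = {u. \<forall>p. u p \<in> meeting B}"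

lemma boundary_map_Suc:
  "boundary_map F (Suc i) u p
    = (if p < frank F i then \<Sum>q<frank F (Suc i). boundary F (Suc i) $$ (p, q) * u q else 0)"
  by (simp add: boundary_map_def)

lemma boundary_map_linear:
  "boundary_map F i (u - w) = boundary_map F i u - boundary_map F i w"
  "boundary_map F i (variable_map v u) = variable_map v (boundary_map F i u)"
  by (cases i; auto simp: fun_eq_iff boundary_map_def variable_map_def algebra_simps
      sum_subtractf sum_distrib_left)+

context
  fixes V :: "'v set" and \<Delta> :: "'v set set" and F :: "('v, 'k::field) mpoly graded_complex"
  assumes sc: "simplicial_complex V \<Delta>" and res: "graded_free_resolution V \<Delta> F"
begin

lemma boundary_homogeneous:
  "p < frank F i \<Longrightarrow> q < frank F (Suc i) \<Longrightarrow>
    boundary F (Suc i) $$ (p, q) \<in> homogeneous_part V (shifts F (Suc i) ! q - shifts F i ! p)"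
  using res unfolding graded_free_resolution_def by blast

lemma boundary_map_mem:
  assumes "u \<in> free_part V F (Suc i) j"
  shows "boundary_map F (Suc i) u \<in> free_part V F i j"
proof -
  have "boundary F (Suc i) $$ (p, q) * u q \<in> homogeneous_part V (j - shifts F i ! p)"
    if "p < frank F i" "q < frank F (Suc i)" for p q
    using homogeneous_part_mult[OF boundary_homogeneous[OF that], of "u q" "j - shifts F (Suc i) ! q"]
      assms that by (auto simp: free_part_def split: if_splits)
  then show ?thesis
    by (auto simp: free_part_def boundary_map_Suc intro!: homogeneous_part_sum)
qed

lemma boundary_carrier: "boundary F (Suc i) \<in> carrier_mat (frank F i) (frank F (Suc i))"
  using res unfolding graded_free_resolution_def by blast

lemma boundary_mult_vec:
  assumes "x \<in> carrier_vec (frank F (Suc i))" "p < frank F i"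
    and "\<And>q. q < frank F (Suc i) \<Longrightarrow> u q = x $ q"
  shows "(boundary F (Suc i) *\<^sub>v x) $ p = boundary_map F (Suc i) u p"
  using assms boundary_carrier[of i]
  by (auto simp: scalar_prod_def boundary_map_Suc lessThan_atLeast0 intro!: sum.cong)

text \<open>Taking in each entry the component of the degree prescribed by the shifts turns an arbitrary
  preimage of a homogeneous vector into a homogeneous one.\<close>

lemma homogeneous_preimage:
  assumes x: "x \<in> free_module V F (Suc i)" and u: "u \<in> free_part V F i j"
    and eq: "\<And>p. p < frank F i \<Longrightarrow> (boundary F (Suc i) *\<^sub>v x) $ p = u p"
  shows "\<exists>z\<in>free_part V F (Suc i) j. boundary_map F (Suc i) z = u"
proof
  define w where "w q = (if q < frank F (Suc i) then x $ q else 0)" for q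
  define z where "z q = homogeneous_component (j - shifts F (Suc i) ! q) (w q)" for q
  have w: "w q \<in> poly_carrier V" for q
    using x poly_carrier_zero by (auto simp: w_def free_module_def)
  have xc: "x \<in> carrier_vec (frank F (Suc i))" using x by (simp add: free_module_def)
  have z0: "z q = 0" if "\<not> q < frank F (Suc i)" for q
    using that homogeneous_component_id[OF homogeneous_part_zero] by (simp add: z_def w_def)
  then show "z \<in> free_part V F (Suc i) j"
    using homogeneous_component_mem[OF w] by (auto simp: free_part_def z_def)
  show "boundary_map F (Suc i) z = u"
  proof
    fix p
    show "boundary_map F (Suc i) z p = u p"
    proof (cases "p < frank F i")
      case True
      let ?j = "j - shifts F i ! p"
      have "boundary F (Suc i) $$ (p, q) * z q
          = homogeneous_component ?j (boundary F (Suc i) $$ (p, q) * w q)"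
        if "q < frank F (Suc i)" for q
        using homogeneous_component_mult[OF boundary_homogeneous[OF True that],
            of "j - shifts F (Suc i) ! q" "w q"]
        by (simp add: z_def)
      then have "boundary_map F (Suc i) z p = homogeneous_component ?j (boundary_map F (Suc i) w p)"
        using True by (simp add: boundary_map_Suc homogeneous_component_sum)
      also have "boundary_map F (Suc i) w p = u p"
        using boundary_mult_vec[OF xc True, of w] eq[OF True] by (simp add: w_def)
      also have "homogeneous_component ?j (u p) = u p"
        using u True by (intro homogeneous_component_id) (auto simp: free_part_def split: if_splits)
      finally show ?thesis .
    next
      case False
      then show ?thesis using u by (auto simp: boundary_map_Suc free_part_def split: if_splits)
    qed
  qed
qed

lemma free_part_to_vec:
  assumes "u \<in> free_part V F i j"
  shows "vec (frank F i) u \<in> free_module V F i"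
  using assms by (auto simp: free_module_def free_part_def homogeneous_part_def split: if_splits)

lemma boundary_vec:
  "boundary F (Suc i) *\<^sub>v vec (frank F (Suc i)) u = vec (frank F i) (boundary_map F (Suc i) u)"
  using boundary_carrier[of i]
  by (intro eq_vecI) (auto simp: boundary_mult_vec[of _ _ _ u] simp del: index_mult_mat_vec)

lemma boundary_map_exact:
  assumes u: "u \<in> free_part V F (Suc i) j"
  shows "boundary_map F (Suc i) u = 0
    \<longleftrightarrow> (\<exists>z\<in>free_part V F (Suc (Suc i)) j. boundary_map F (Suc (Suc i)) z = u)"
proof -
  have ex: "{x \<in> free_module V F (Suc i). boundary F (Suc i) *\<^sub>v x = 0\<^sub>v (frank F i)}
      = (\<lambda>y. boundary F (Suc (Suc i)) *\<^sub>v y) ` free_module V F (Suc (Suc i))"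
    using res unfolding graded_free_resolution_def by blast
  let ?x = "vec (frank F (Suc i)) u"
  have zero: "boundary_map F (Suc i) u = 0 \<longleftrightarrow> boundary F (Suc i) *\<^sub>v ?x = 0\<^sub>v (frank F i)"
    unfolding boundary_vec by (auto simp: fun_eq_iff vec_eq_iff boundary_map_Suc)
  show ?thesis
  proof
    assume "boundary_map F (Suc i) u = 0"
    then have "?x \<in> (\<lambda>y. boundary F (Suc (Suc i)) *\<^sub>v y) ` free_module V F (Suc (Suc i))"
      using zero free_part_to_vec[OF u] ex by blast
    then obtain y where y: "y \<in> free_module V F (Suc (Suc i))"
      and eq: "boundary F (Suc (Suc i)) *\<^sub>v y = ?x" by auto
    show "\<exists>z\<in>free_part V F (Suc (Suc i)) j. boundary_map F (Suc (Suc i)) z = u"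
      by (rule homogeneous_preimage[OF y u]) (simp add: eq)
  next
    assume "\<exists>z\<in>free_part V F (Suc (Suc i)) j. boundary_map F (Suc (Suc i)) z = u"
    then obtain z where z: "z \<in> free_part V F (Suc (Suc i)) j" "boundary_map F (Suc (Suc i)) z = u"
      by blast
    have "?x \<in> (\<lambda>y. boundary F (Suc (Suc i)) *\<^sub>v y) ` free_module V F (Suc (Suc i))"
      by (rule image_eqI[OF _ free_part_to_vec[OF z(1)]]) (simp add: boundary_vec z(2))
    then show "boundary_map F (Suc i) u = 0" using ex zero by blast
  qed
qed

lemma graded_resolution_free_part:
  "graded_resolution V (free_part V F) (boundary_map F) variable_map meeting_vectors"
proof
  fix i :: nat and j :: int and u w :: "nat \<Rightarrow> ('v, 'k) mpoly" and v x :: 'v and B C :: "'v set"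
  show "0 \<in> free_part V F i j" by (simp add: free_part_def homogeneous_part_zero)
  show "u - w \<in> free_part V F i j" if "u \<in> free_part V F i j" "w \<in> free_part V F i j"
    using that by (auto simp: free_part_def homogeneous_part_diff split: if_splits)
  show "\<exists>l. \<forall>j<l. free_part V F i j \<subseteq> {0}"
  proof (intro exI allI impI subsetI)
    fix j u assume j: "j < Min (insert 0 (set (shifts F i)))" and u: "u \<in> free_part V F i j"
    have "u p = 0" for p
    proof (cases "p < frank F i")
      case True
      then have "shifts F i ! p \<in> set (shifts F i)" by (simp add: frank_def)
      then have "j - shifts F i ! p < 0" using j by auto
      moreover have "u p \<in> homogeneous_part V (j - shifts F i ! p)"
        using u True by (auto simp: free_part_def split: if_splits)
      ultimately show ?thesis by (rule homogeneous_part_neg)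
    qed (use u in \<open>auto simp: free_part_def split: if_splits\<close>)
    then show "u \<in> {0}" by auto
  qed
  show "boundary_map F 0 u = 0" by (simp add: boundary_map_def fun_eq_iff)
  show "boundary_map F i (u - w) = boundary_map F i u - boundary_map F i w"
    "boundary_map F i (variable_map v u) = variable_map v (boundary_map F i u)"
    by (rule boundary_map_linear)+
  show "boundary_map F (Suc i) u \<in> free_part V F i j" if "u \<in> free_part V F (Suc i) j"
    using that by (rule boundary_map_mem)
  show "boundary_map F i (boundary_map F (Suc i) u) = 0" if "u \<in> free_part V F (Suc i) j"
  proof (cases i)
    case 0
    then show ?thesis by (simp add: boundary_map_def fun_eq_iff)
  next
    case (Suc k)
    then show ?thesis using that boundary_map_exact[of "boundary_map F (Suc i) u" k j]
        boundary_map_mem[of u "Suc k" j] by blast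
  qed
  show "\<exists>z\<in>free_part V F (Suc (Suc i)) j. boundary_map F (Suc (Suc i)) z = u"
    if "u \<in> free_part V F (Suc i) j" "boundary_map F (Suc i) u = 0"
    using boundary_map_exact that by blast
  show "variable_map v (u - w) = variable_map v u - variable_map v w"
    by (simp add: variable_map_def fun_eq_iff algebra_simps)
  show "variable_map v (variable_map x u) = variable_map x (variable_map v u)"
    by (simp add: variable_map_def fun_eq_iff algebra_simps)
  show "variable_map v u \<in> free_part V F i (j + 1)" if "v \<in> V" "u \<in> free_part V F i j"
    unfolding free_part_def
  proof (intro CollectI allI)
    fix p
    have shift: "1 + (j - shifts F i ! p) = j + 1 - shifts F i ! p" by simp
    show "if p < frank F i then variable_map v u p \<in> homogeneous_part V (j + 1 - shifts F i ! p)
        else variable_map v u p = 0"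
      using homogeneous_part_mult[OF variable_homogeneous[OF that(1)], of "u p" "j - shifts F i ! p",
          unfolded shift] that(2)
      by (auto simp: free_part_def variable_map_def split: if_splits)
  qed
  show "0 \<in> (meeting_vectors B :: (nat \<Rightarrow> ('v, 'k) mpoly) set)"
    by (simp add: meeting_vectors_def meeting_zero)
  show "u - w \<in> meeting_vectors B" if "u \<in> meeting_vectors B" "w \<in> meeting_vectors B"
    using that by (simp add: meeting_vectors_def meeting_diff)
  show "(meeting_vectors {} :: (nat \<Rightarrow> ('v, 'k) mpoly) set) = {0}"
    by (auto simp: meeting_vectors_def meeting_empty fun_eq_iff)
  show "meeting_vectors B \<subseteq> (meeting_vectors C :: (nat \<Rightarrow> ('v, 'k) mpoly) set)" if "B \<subseteq> C"
    using that by (fastforce simp: meeting_vectors_def meeting_def)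
  show "boundary_map F i u \<in> meeting_vectors B" if "u \<in> meeting_vectors B"
    using that by (cases i)
      (auto simp: meeting_vectors_def boundary_map_def meeting_zero intro!: meeting_sum meeting_mult)
  show "variable_map v u \<in> meeting_vectors B" if "u \<in> meeting_vectors B"
    using that by (simp add: meeting_vectors_def variable_map_def meeting_mult)
  show "variable_map v u \<in> meeting_vectors B" if "v \<in> B"
    using that by (simp add: meeting_vectors_def variable_map_def variable_mult_meeting)
  show "u \<in> meeting_vectors B" if "v \<notin> B" "variable_map v u \<in> meeting_vectors B"
    using that by (auto simp: meeting_vectors_def variable_map_def intro: meeting_cancel)
  show "\<exists>y\<in>free_part V F i (j - 1). u - variable_map v y \<in> meeting_vectors B"
    if u: "u \<in> free_part V F i j" "u \<in> meeting_vectors (insert v B)"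
  proof -
    have "\<exists>g. (if p < frank F i then g \<in> homogeneous_part V (j - 1 - shifts F i ! p) else g = 0)
        \<and> u p - variable v * g \<in> meeting B" for p
    proof (cases "p < frank F i")
      case True
      have "j - shifts F i ! p - 1 = j - 1 - shifts F i ! p" by simp
      moreover have "u p \<in> homogeneous_part V (j - shifts F i ! p)" "u p \<in> meeting (insert v B)"
        using u True by (auto simp: free_part_def meeting_vectors_def split: if_splits)
      ultimately show ?thesis using meeting_insert True by metis
    next
      case False
      then show ?thesis using u by (auto simp: free_part_def meeting_zero split: if_splits)
    qed
    then obtain y where "\<And>p. (if p < frank F i then y p \<in> homogeneous_part V (j - 1 - shifts F i ! p)
        else y p = 0) \<and> u p - variable v * y p \<in> meeting B" by metis
    then show ?thesis
      by (intro bexI[of _ y]) (auto simp: free_part_def meeting_vectors_def variable_map_def)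
  qed
qed

lemma shifts_0: "shifts F 0 = [0]" and frank_0: "frank F 0 = 1"
  using res by (simp_all add: graded_free_resolution_def frank_def)

lemma boundary_image:
  "(\<lambda>y. (boundary F 1 *\<^sub>v y) $ 0) ` free_module V F 1
    = a_kernel (poly_ring V) (sr_ring V \<Delta>) (sr_proj V \<Delta>)"
  using res by (simp add: graded_free_resolution_def)

lemma boundary_map_1_nonface:
  assumes "z \<in> free_part V F 1 j"
  shows "boundary_map F 1 z 0 \<in> nonface_supported V \<Delta>"
proof -
  have "boundary_map F 1 z 0 = (boundary F 1 *\<^sub>v vec (frank F 1) z) $ 0"
    using boundary_vec[of 0 z] by (simp add: frank_0)
  then show ?thesis
    using free_part_to_vec[OF assms] boundary_image kernel_sr_proj_subset[OF sc] by blast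
qed

text \<open>Every vertex is a face, so the Stanley-Reisner ideal contains no nonzero element of degree at most
  one.  An element of such a degree in the first module is hence mapped to zero, and exactness applies.\<close>

lemma acyclic_mod_1:
  assumes "j \<le> 1"
  shows "graded_resolution.acyclic_mod (free_part V F) (boundary_map F) meeting_vectors B 1 j"
proof -
  interpret graded_resolution V "free_part V F" "boundary_map F" variable_map meeting_vectors
    by (rule graded_resolution_free_part)
  show ?thesis unfolding acyclic_mod_def
  proof (intro ballI impI)
    fix u assume u: "u \<in> free_part V F 1 j"
    let ?f = "boundary_map F 1 u"
    have f: "?f \<in> free_part V F 0 j" using D_mem[of u 0 j] u by simp
    have "m \<notin> Poly_Mapping.keys (?f 0)" for m
    proof
      assume m: "m \<in> Poly_Mapping.keys (?f 0)"
      have "?f 0 \<in> homogeneous_part V j"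
        using f by (auto simp: free_part_def frank_0 shifts_0 split: if_splits)
      then have "card (Poly_Mapping.keys m) \<le> 1" and mV: "Poly_Mapping.keys m \<subseteq> V"
        using m assms card_keys_le_mono_degree[of m]
        by (auto simp: homogeneous_part_def poly_carrier_def)
      then consider "Poly_Mapping.keys m = {}" | v where "Poly_Mapping.keys m = {v}" "v \<in> V"
        by (auto simp: le_Suc_eq card_Suc_eq)
      then have "Poly_Mapping.keys m \<in> \<Delta>"
        using sc by cases (auto simp: simplicial_complex_def)
      then show False
        using boundary_map_1_nonface[OF u] m by (auto simp: nonface_supported_def)
    qed
    then have "Poly_Mapping.keys (?f 0) = {}" by blast
    then have "?f 0 = 0" by simp
    then have "?f = 0"
      using f by (auto simp: fun_eq_iff free_part_def frank_0 split: if_splits)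
    then obtain z where "z \<in> free_part V F (Suc 1) j" "boundary_map F (Suc 1) z = u"
      using exact[of u 0 j] u by auto
    then show "\<exists>z\<in>free_part V F (Suc 1) j. u - boundary_map F (Suc 1) z \<in> meeting_vectors B"
      using N_zero by force
  qed
qed

text \<open>Otherwise all of the \<open>i\<close>-th module in degrees above \<open>i\<close> consists of multiples of variables, so its
  homology modulo all variables is confined to degrees \<open>\<le> i\<close>, where it vanishes.  By Nakayama it then
  vanishes modulo every set of variables, against the class lifted from the monomial of the facet.\<close>

lemma exists_large_shift:
  assumes \<sigma>: "\<sigma> \<in> \<Delta>" and facet: "\<And>v. v \<in> V \<Longrightarrow> v \<notin> \<sigma> \<Longrightarrow> insert v \<sigma> \<notin> \<Delta>"
    and i: "1 \<le> i" "i \<le> card V - card \<sigma>"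
  shows "\<exists>j\<in>set (shifts F i). j \<ge> int i + 1"
proof (rule ccontr)
  assume neg: "\<not> ?thesis"
  interpret graded_resolution V "free_part V F" "boundary_map F" variable_map meeting_vectors
    by (rule graded_resolution_free_part)
  have V: "finite V" and \<sigma>V: "\<sigma> \<subseteq> V" using sc \<sigma> by (auto simp: simplicial_complex_def)
  have \<sigma>fin: "finite \<sigma>" using V \<sigma>V finite_subset by blast
  have acV: "acyclic_mod V i j" for j
  proof (cases "j \<le> int i")
    case True
    show ?thesis
      by (rule acyclic_mod_below_diagonal) (use True V i acyclic_mod_1 in auto)
  next
    case False
    have "u \<in> meeting_vectors V" if u: "u \<in> free_part V F i j" for u
      unfolding meeting_vectors_def meeting_def
    proof (intro CollectI allI ballI)
      fix p m assume m: "m \<in> Poly_Mapping.keys (u p)"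
      then have p: "p < frank F i" using u by (auto simp: free_part_def split: if_splits)
      then have "shifts F i ! p \<in> set (shifts F i)" by (simp add: frank_def)
      then have "j - shifts F i ! p > 0" using neg False by force
      moreover have "u p \<in> homogeneous_part V (j - shifts F i ! p)"
        using u p by (auto simp: free_part_def split: if_splits)
      ultimately have "mono_degree m > 0" "Poly_Mapping.keys m \<subseteq> V"
        using m by (auto simp: homogeneous_part_def poly_carrier_def)
      then show "Poly_Mapping.keys m \<inter> V \<noteq> {}" using mono_degree_pos by blast
    qed
    then show ?thesis
      unfolding acyclic_mod_def using M_zero D_zero by (metis diff_zero)
  qed
  (* the squarefree monomials, as vectors in the module of rank one at the end of the resolution *)
  define mon :: "'v set \<Rightarrow> nat \<Rightarrow> ('v, 'k) mpoly" where
    "mon \<tau> p = (if p = 0 then \<Prod>v\<in>\<tau>. variable v else 0)" for \<tau> p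
  have mon_mem: "mon \<tau> \<in> free_part V F 0 (int (card \<tau>))" if "\<tau> \<subseteq> V" for \<tau>
  proof -
    have "finite \<tau>" using that V finite_subset by blast
    then have "(\<Prod>v\<in>\<tau>. variable v) \<in> homogeneous_part V (int (card \<tau>))" using that
    proof (induction \<tau> rule: finite_induct)
      case empty
      then show ?case by (auto simp: homogeneous_part_def poly_carrier_one mono_degree_def)
    next
      case (insert v \<tau>)
      then show ?case
        using homogeneous_part_mult[OF variable_homogeneous[of v V], of "\<Prod>v\<in>\<tau>. variable v" "int (card \<tau>)"]
        by simp
    qed
    then show ?thesis by (auto simp: free_part_def mon_def frank_0 shifts_0)
  qed
  obtain B where B: "B \<subseteq> V - \<sigma>" "card B = i"
    using obtain_subset_with_card_n[of i "V - \<sigma>"] i card_Diff_subset[OF \<sigma>fin \<sigma>V] by auto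
  have "\<exists>j. \<not> acyclic_mod B (card B) j"
  proof (rule not_acyclic_mod)
    show "mon \<sigma> \<in> free_part V F 0 (int (card \<sigma>))" by (rule mon_mem[OF \<sigma>V])
    show "boundary_map F 1 z \<noteq> mon \<sigma>" if z: "z \<in> free_part V F 1 (int (card \<sigma>))" for z
    proof
      assume "boundary_map F 1 z = mon \<sigma>"
      then have "(\<Prod>v\<in>\<sigma>. variable v :: ('v, 'k) mpoly) \<in> nonface_supported V \<Delta>"
        using boundary_map_1_nonface[OF z] by (simp add: mon_def)
      then show False
        using \<sigma> keys_sum_single[OF \<sigma>fin] by (auto simp: nonface_supported_def keys_prod_variable[OF \<sigma>fin])
    qed
    show "\<exists>z\<in>free_part V F 1 (int (card \<sigma>) + 1). boundary_map F 1 z = variable_map v (mon \<sigma>)"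
      if v: "v \<in> V - \<sigma>" for v
    proof -
      have e: "variable_map v (mon \<sigma>) = mon (insert v \<sigma>)"
        using v \<sigma>fin by (auto simp: variable_map_def mon_def fun_eq_iff)
      have "(\<Prod>v\<in>insert v \<sigma>. variable v) \<in> (\<lambda>y. (boundary F 1 *\<^sub>v y) $ 0) ` free_module V F 1"
        unfolding boundary_image
        using nonface_monomial_in_kernel[OF sc, of "insert v \<sigma>"] facet[of v] v \<sigma>V by auto
      then obtain y where y: "y \<in> free_module V F 1"
        and eq: "(boundary F 1 *\<^sub>v y) $ 0 = (\<Prod>v\<in>insert v \<sigma>. variable v)" by auto
      have "mon (insert v \<sigma>) \<in> free_part V F 0 (int (card \<sigma>) + 1)"
        using mon_mem[of "insert v \<sigma>"] v \<sigma>V \<sigma>fin by (simp add: add.commute)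
      then show ?thesis
        using homogeneous_preimage[of y 0 "mon (insert v \<sigma>)"] y eq
        unfolding e by (simp add: frank_0 mon_def)
    qed
  qed (use B V in auto)
  then show False
    using acyclic_mod_of_all_variables[OF V _ acV, of B] B by auto
qed

end

section \<open>Products of the ratios of maximal shifts to their indices\<close>

text \<open>Each factor \<open>m\<^sub>i / i\<close> is at least \<open>(i + 1) / i\<close>, and these telescope.\<close>

lemma prod_ratio_lower_bound:
  fixes m :: "nat \<Rightarrow> real"
  assumes "k \<le> l" and "\<And>i. 1 \<le> i \<Longrightarrow> i \<le> l \<Longrightarrow> m i \<ge> real i + 1"
  shows "(\<Prod>i=1..k. m i / real i) * ((real l + 1) / (real k + 1)) \<le> (\<Prod>i=1..l. m i / real i)"
  using assms
proof (induction l rule: dec_induct)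
  case base
  then show ?case by simp
next
  case (step l)
  let ?P = "\<lambda>k. \<Prod>i=1..k. m i / real i"
  have "real l + 1 \<noteq> 0" by linarith
  then have "?P k * ((real (Suc l) + 1) / (real k + 1))
      = ?P k * ((real l + 1) / (real k + 1)) * ((real l + 2) / (real l + 1))"
    by simp
  also have "\<dots> \<le> ?P l * (m (Suc l) / real (Suc l))"
  proof (rule mult_mono)
    show "?P k * ((real l + 1) / (real k + 1)) \<le> ?P l" using step by simp
    show "(real l + 2) / (real l + 1) \<le> m (Suc l) / real (Suc l)"
      using step.prems(1)[of "Suc l"] by (simp add: divide_right_mono add.commute)
    show "0 \<le> ?P l"
      by (rule prod_nonneg) (use step.prems in \<open>force intro!: divide_nonneg_nonneg\<close>)
  qed simp
  finally show ?case by simp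
qed

lemma prod_ratio_ge_1:
  fixes m :: "nat \<Rightarrow> real"
  assumes "\<And>i. 1 \<le> i \<Longrightarrow> i \<le> l \<Longrightarrow> m i \<ge> real i + 1"
  shows "(\<Prod>i=1..l. m i / real i) \<ge> real l + 1"
  using prod_ratio_lower_bound[of 0 l m] assms by simp

lemma prod_ratio_mono:
  fixes m :: "nat \<Rightarrow> real"
  assumes "k \<le> l" and m: "\<And>i. 1 \<le> i \<Longrightarrow> i \<le> l \<Longrightarrow> m i \<ge> real i + 1"
  shows "(\<Prod>i=1..k. m i / real i) \<le> (\<Prod>i=1..l. m i / real i)"
proof -
  have "(\<Prod>i=1..k. m i / real i) \<ge> real k + 1"
    by (rule prod_ratio_ge_1) (use assms in auto)
  then have "(\<Prod>i=1..k. m i / real i) * 1 \<le> (\<Prod>i=1..k. m i / real i) * ((real l + 1) / (real k + 1))"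
    using assms(1) by (intro mult_left_mono) auto
  then show ?thesis using prod_ratio_lower_bound[OF assms] by linarith
qed

text \<open>The telescoping estimate from \<open>a\<close> to \<open>n - 1\<close>, together with the large last factor, bounds the
  product to \<open>n\<close> below by \<open>(a + b + 2) / (a + 1)\<close> times the product to \<open>a\<close>.  The same estimate from
  \<open>b\<close> to \<open>a\<close> turns the excess \<open>(b + 1) / (a + 1)\<close> into the product to \<open>b\<close>.\<close>

lemma prod_ratio_superadditive:
  fixes m :: "nat \<Rightarrow> real"
  assumes m: "\<And>i. 1 \<le> i \<Longrightarrow> i \<le> n \<Longrightarrow> m i \<ge> real i + 1"
    and "b \<le> a" "a < n" and mn: "m n \<ge> real a + real b + 2"
  shows "(\<Prod>i=1..a. m i / real i) + (\<Prod>i=1..b. m i / real i) \<le> (\<Prod>i=1..n. m i / real i)"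
proof -
  let ?P = "\<lambda>k. \<Prod>i=1..k. m i / real i"
  obtain l where l: "n = Suc l" using assms by (cases n) auto
  have Pa: "?P a \<ge> 0"
    using prod_ratio_ge_1[of a m] m assms by force
  have "?P b \<le> ?P a * ((real b + 1) / (real a + 1))"
    using prod_ratio_lower_bound[of b a m] m assms(2,3) by (simp add: field_simps)
  then have "?P a + ?P b \<le> ?P a * ((real a + real b + 2) / (real a + 1))"
    by (simp add: field_simps)
  also have "\<dots> \<le> ?P a * (m n / (real a + 1))"
    using Pa mn by (intro mult_left_mono divide_right_mono) auto
  also have "\<dots> = ?P a * ((real l + 1) / (real a + 1)) * (m n / real n)"
  proof -
    have "real n = real l + 1" "real l + 1 \<noteq> 0" using l by auto
    then show ?thesis by simp
  qed
  also have "\<dots> \<le> ?P l * (m n / real n)"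
    using prod_ratio_lower_bound[of a l m] m[of n] m l assms(3)
    by (intro mult_right_mono) auto
  also have "\<dots> = ?P n" using l by simp
  finally show ?thesis .
qed

section \<open>Gluing along few vertices\<close>

text \<open>One more than the dimension, as a natural number.\<close>

definition max_face_card :: "'v set set \<Rightarrow> nat" where
  "max_face_card \<Delta> = Max (card ` \<Delta>)"

lemma complex_dim_eq: "complex_dim \<Delta> = int (max_face_card \<Delta>) - 1"
  by (simp add: complex_dim_def max_face_card_def)

lemma simplicial_complex_finite: "simplicial_complex V \<Delta> \<Longrightarrow> finite \<Delta>"
  unfolding simplicial_complex_def by (metis finite_Pow_iff finite_subset)

lemma card_face_le: "simplicial_complex V \<Delta> \<Longrightarrow> \<sigma> \<in> \<Delta> \<Longrightarrow> card \<sigma> \<le> max_face_card \<Delta>"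
  unfolding max_face_card_def by (simp add: simplicial_complex_finite)

lemma exists_max_face:
  assumes "simplicial_complex V \<Delta>"
  obtains \<sigma> where "\<sigma> \<in> \<Delta>" "card \<sigma> = max_face_card \<Delta>"
proof -
  have "max_face_card \<Delta> \<in> card ` \<Delta>"
    unfolding max_face_card_def using assms simplicial_complex_finite[OF assms]
    by (intro Max_in) (auto simp: simplicial_complex_def)
  then show ?thesis using that by auto
qed

lemma finite_face: "simplicial_complex V \<Delta> \<Longrightarrow> \<sigma> \<in> \<Delta> \<Longrightarrow> finite \<sigma>"
  unfolding simplicial_complex_def by (metis PowD finite_subset subsetD)

lemma face_number_eq: "face_number \<Delta> (int k - 1) = card {\<sigma> \<in> \<Delta>. card \<sigma> = k}"
  by (simp add: face_number_def)

text \<open>A face of maximal cardinality is a facet whose complement has as many vertices as the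
  codimension.\<close>

lemma max_shift_lower_bound:
  assumes sc: "simplicial_complex V \<Delta>" and res: "graded_free_resolution V \<Delta> F"
    and i: "1 \<le> i" "i \<le> card V - max_face_card \<Delta>"
  shows "max_shift_defined F i" "max_shift F i \<ge> int i + 1"
proof -
  obtain \<sigma> where \<sigma>: "\<sigma> \<in> \<Delta>" "card \<sigma> = max_face_card \<Delta>"
    using exists_max_face[OF sc] .
  have "insert v \<sigma> \<notin> \<Delta>" if "v \<notin> \<sigma>" for v
    using card_face_le[OF sc, of "insert v \<sigma>"] that \<sigma> finite_face[OF sc \<sigma>(1)] by auto
  then obtain j where j: "j \<in> set (shifts F i)" "j \<ge> int i + 1"
    using exists_large_shift[OF sc res \<sigma>(1) _ i(1)] i(2) \<sigma>(2) by auto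
  then show "max_shift_defined F i"
    by (auto simp: max_shift_defined_def frank_def)
  have "{j. graded_betti F i j \<noteq> 0} = set (shifts F i)"
    by (auto simp: graded_betti_def count_list_0_iff)
  then have "j \<le> max_shift F i" using j(1) by (simp add: max_shift_def)
  then show "max_shift F i \<ge> int i + 1" using j(2) by linarith
qed

lemma multiplicity_upper_bound_iff:
  "multiplicity_upper_bound V \<Delta> F \<longleftrightarrow>
     real (card {\<sigma> \<in> \<Delta>. card \<sigma> = max_face_card \<Delta>})
       \<le> (\<Prod>i=1..card V - max_face_card \<Delta>. real_of_int (max_shift F i) / real i)"
  by (simp add: multiplicity_upper_bound_def complex_dim_eq Let_def face_number_eq
      prod_dividef fact_prod)

text \<open>Comparing the products factor by factor requires the maximal shifts of \<open>F\<close> in the range of the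
  product to be defined and nonnegative.\<close>

lemma multiplicity_bound_transfer:
  assumes sc: "simplicial_complex V \<Delta>" and res: "graded_free_resolution V \<Delta> F"
    and le: "max_shifts_le F F'" and bound: "multiplicity_upper_bound V \<Delta> F"
  shows "real (card {\<sigma> \<in> \<Delta>. card \<sigma> = max_face_card \<Delta>})
       \<le> (\<Prod>i=1..card V - max_face_card \<Delta>. real_of_int (max_shift F' i) / real i)"
proof -
  have "(\<Prod>i=1..card V - max_face_card \<Delta>. real_of_int (max_shift F i) / real i)
      \<le> (\<Prod>i=1..card V - max_face_card \<Delta>. real_of_int (max_shift F' i) / real i)"
  proof (rule prod_mono)
    fix i assume "i \<in> {1..card V - max_face_card \<Delta>}"
    then have "max_shift_defined F i" "max_shift F i \<ge> int i + 1"
      using max_shift_lower_bound[OF sc res] by auto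
    then show "0 \<le> real_of_int (max_shift F i) / real i
        \<and> real_of_int (max_shift F i) / real i \<le> real_of_int (max_shift F' i) / real i"
      using le by (auto simp: max_shifts_le_def divide_right_mono)
  qed
  then show ?thesis using bound unfolding multiplicity_upper_bound_iff by linarith
qed

lemma simplicial_complex_union:
  assumes "simplicial_complex V \<Delta>" "simplicial_complex V' \<Delta>'"
  shows "simplicial_complex (V \<union> V') (\<Delta> \<union> \<Delta>')"
  unfolding simplicial_complex_def
proof (intro conjI ballI allI impI)
  show "\<tau> \<in> \<Delta> \<union> \<Delta>'" if "\<sigma> \<in> \<Delta> \<union> \<Delta>'" "\<tau> \<subseteq> \<sigma>" for \<sigma> \<tau>
    using that face_subset[OF assms(1)] face_subset[OF assms(2)] by (metis Un_iff)
qed (use assms in \<open>auto simp: simplicial_complex_def\<close>)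

lemma max_face_card_union:
  assumes "simplicial_complex V \<Delta>" "simplicial_complex V' \<Delta>'"
  shows "max_face_card (\<Delta> \<union> \<Delta>') = max (max_face_card \<Delta>) (max_face_card \<Delta>')"
  unfolding max_face_card_def image_Un
  using assms simplicial_complex_finite[OF assms(1)] simplicial_complex_finite[OF assms(2)]
  by (intro Max_Un) (auto simp: simplicial_complex_def)

lemma no_faces_above_max:
  assumes "simplicial_complex V \<Delta>" "max_face_card \<Delta> < k"
  shows "card {\<sigma> \<in> \<Delta>. card \<sigma> = k} = 0"
proof -
  have "{\<sigma> \<in> \<Delta>. card \<sigma> = k} = {}" using card_face_le[OF assms(1)] assms(2) by fastforce
  then show ?thesis by (metis card.empty)
qed

theorem theorem4p1:
  fixes V V' :: "'v set" and \<Gamma> \<Gamma>' :: "'v set set"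
    and F F' Fhat :: "('v, 'k::field) mpoly graded_complex"
    and nhat d t :: nat
  assumes "simplicial_complex V \<Gamma>" and "simplicial_complex V' \<Gamma>'"
    and "\<Gamma> = induced_subcomplex (\<Gamma> \<union> \<Gamma>') V"
    and "\<Gamma>' = induced_subcomplex (\<Gamma> \<union> \<Gamma>') V'"
    and "nhat = card (V \<union> V')"
    and "complex_dim (\<Gamma> \<union> \<Gamma>') = int d - 1"
    and "graded_free_resolution V \<Gamma> F"
    and "graded_free_resolution V' \<Gamma>' F'"
    and "graded_free_resolution (V \<union> V') (\<Gamma> \<union> \<Gamma>') Fhat"
    and "max_shifts_le F Fhat" and "max_shifts_le F' Fhat"
    and "max_shift Fhat (nhat - d) = int (nhat - d) + int t + 1"
    and "multiplicity_upper_bound V \<Gamma> F"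
    and "multiplicity_upper_bound V' \<Gamma>' F'"
    and "int (face_number (\<Gamma> \<inter> \<Gamma>') 0) \<le> int t + int d - 1"
  shows "multiplicity_upper_bound (V \<union> V') (\<Gamma> \<union> \<Gamma>') Fhat"
proof -
  note sc = assms(1) and sc' = assms(2)
  have U: "simplicial_complex (V \<union> V') (\<Gamma> \<union> \<Gamma>')" by (rule simplicial_complex_union[OF sc sc'])
  have d: "max_face_card (\<Gamma> \<union> \<Gamma>') = d" using assms(6) by (simp add: complex_dim_eq)
  have dmax: "d = max (max_face_card \<Gamma>) (max_face_card \<Gamma>')"
    using max_face_card_union[OF sc sc'] d by simp
  have fin: "finite V" "finite V'" using sc sc' by (auto simp: simplicial_complex_def)
  define N a b where "N = nhat - d" and "a = card V - d" and "b = card V' - d"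
  let ?m = "\<lambda>i. real_of_int (max_shift Fhat i)"
  let ?P = "\<lambda>k. \<Prod>i=1..k. ?m i / real i"
  let ?f = "\<lambda>\<Delta>. real (card {\<sigma> \<in> \<Delta>. card \<sigma> = d})"
  have m: "?m i \<ge> real i + 1" if "1 \<le> i" "i \<le> N" for i
    using max_shift_lower_bound(2)[OF U assms(9) that(1)] that d assms(5)
    by (simp add: N_def)
  have goal: "?thesis \<longleftrightarrow> ?f (\<Gamma> \<union> \<Gamma>') \<le> ?P N"
    using assms(5) by (simp add: multiplicity_upper_bound_iff d N_def)
  have le: "a \<le> N" "b \<le> N"
    unfolding a_def b_def N_def assms(5) using fin by (auto intro!: diff_le_mono card_mono)
  have mono: "?P a \<le> ?P N" "?P b \<le> ?P N"
    using prod_ratio_mono[OF le(1) m] prod_ratio_mono[OF le(2) m] by auto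
  have P_nonneg: "?P a \<ge> 0" "?P b \<ge> 0"
    using prod_ratio_ge_1[of a ?m] prod_ratio_ge_1[of b ?m] m le by force+
  have fa: "?f \<Gamma> \<le> ?P a" if "max_face_card \<Gamma> = d"
    using multiplicity_bound_transfer[OF sc assms(7) assms(10) assms(13)] that by (simp add: a_def)
  have fb: "?f \<Gamma>' \<le> ?P b" if "max_face_card \<Gamma>' = d"
    using multiplicity_bound_transfer[OF sc' assms(8) assms(11) assms(14)] that by (simp add: b_def)
  have fa0: "?f \<Gamma> = 0" if "max_face_card \<Gamma> \<noteq> d"
    using no_faces_above_max[OF sc, of d] dmax that by simp
  have fb0: "?f \<Gamma>' = 0" if "max_face_card \<Gamma>' \<noteq> d"
    using no_faces_above_max[OF sc', of d] dmax that by simp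
  have "{\<sigma> \<in> \<Gamma> \<union> \<Gamma>'. card \<sigma> = d} = {\<sigma> \<in> \<Gamma>. card \<sigma> = d} \<union> {\<sigma> \<in> \<Gamma>'. card \<sigma> = d}" by auto
  then have sum: "?f (\<Gamma> \<union> \<Gamma>') \<le> ?f \<Gamma> + ?f \<Gamma>'"
    using card_Un_le[of "{\<sigma> \<in> \<Gamma>. card \<sigma> = d}" "{\<sigma> \<in> \<Gamma>'. card \<sigma> = d}"] by simp
  have "?f (\<Gamma> \<union> \<Gamma>') \<le> ?P N"
  proof -
    consider "max_face_card \<Gamma> \<noteq> d" | "max_face_card \<Gamma>' \<noteq> d"
      | "V' \<subseteq> V" "max_face_card \<Gamma> = d" | "V \<subseteq> V'" "max_face_card \<Gamma>' = d"
      | "\<not> V' \<subseteq> V" "\<not> V \<subseteq> V'" "max_face_card \<Gamma> = d" "max_face_card \<Gamma>' = d"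
      by blast
    then show ?thesis
    proof cases
      case 1
      then have "max_face_card \<Gamma>' = d" using dmax by (simp add: max_def split: if_splits)
      then show ?thesis using sum fa0[OF 1] fb mono by linarith
    next
      case 2
      then have "max_face_card \<Gamma> = d" using dmax by (simp add: max_def split: if_splits)
      then show ?thesis using sum fb0[OF 2] fa mono by linarith
    next
      case 3
      have "\<Gamma>' \<subseteq> Pow V'" using sc' by (simp add: simplicial_complex_def)
      then have "\<Gamma>' \<subseteq> induced_subcomplex (\<Gamma> \<union> \<Gamma>') V"
        using 3(1) by (auto simp: induced_subcomplex_def)
      then have "\<Gamma> \<union> \<Gamma>' = \<Gamma>" using assms(3) by blast
      then show ?thesis using fa[OF 3(2)] mono by simp
    next
      case 4
      have "\<Gamma> \<subseteq> Pow V" using sc by (simp add: simplicial_complex_def)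
      then have "\<Gamma> \<subseteq> induced_subcomplex (\<Gamma> \<union> \<Gamma>') V'"
        using 4(1) by (auto simp: induced_subcomplex_def)
      then have "\<Gamma> \<union> \<Gamma>' = \<Gamma>'" using assms(4) by blast
      then show ?thesis using fb[OF 4(2)] mono by simp
    next
      case 5
      (* the only case in which the bound on the number of common vertices enters *)
      obtain \<sigma> where "\<sigma> \<in> \<Gamma>" "card \<sigma> = d" using exists_max_face[OF sc] 5 by metis
      then have "d \<le> card V" using sc fin by (auto simp: simplicial_complex_def intro: card_mono)
      obtain \<tau> where "\<tau> \<in> \<Gamma>'" "card \<tau> = d" using exists_max_face[OF sc'] 5 by metis
      then have "d \<le> card V'" using sc' fin by (auto simp: simplicial_complex_def intro: card_mono)
      have "card V < nhat" "card V' < nhat"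
        unfolding assms(5) using 5 fin by (auto intro!: psubset_card_mono)
      then have lt: "a < N" "b < N"
        using \<open>d \<le> card V\<close> \<open>d \<le> card V'\<close> by (auto simp: a_def b_def N_def)
      have "(\<lambda>v. {v}) ` (V \<inter> V') \<subseteq> {\<sigma> \<in> \<Gamma> \<inter> \<Gamma>'. card \<sigma> = 1}"
        using sc sc' by (auto simp: simplicial_complex_def)
      moreover have "finite {\<sigma> \<in> \<Gamma> \<inter> \<Gamma>'. card \<sigma> = 1}" using simplicial_complex_finite[OF sc] by simp
      ultimately have "card ((\<lambda>v. {v}) ` (V \<inter> V')) \<le> card {\<sigma> \<in> \<Gamma> \<inter> \<Gamma>'. card \<sigma> = 1}"
        by (intro card_mono)
      then have "card (V \<inter> V') \<le> face_number (\<Gamma> \<inter> \<Gamma>') 0"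
        using face_number_eq[of "\<Gamma> \<inter> \<Gamma>'" 1] by (simp add: card_image)
      moreover have "card V + card V' = nhat + card (V \<inter> V')"
        unfolding assms(5) by (rule card_Un_Int[OF fin])
      ultimately have "a + b + 1 \<le> N + t"
        using assms(15) \<open>d \<le> card V\<close> \<open>d \<le> card V'\<close> \<open>card V < nhat\<close>
        unfolding a_def b_def N_def by linarith
      then have mN: "?m N \<ge> real a + real b + 2"
        using assms(12) unfolding N_def[symmetric] by simp
      have "?P a + ?P b \<le> ?P N"
      proof (cases "b \<le> a")
        case True
        then show ?thesis using prod_ratio_superadditive[of N ?m b a] m mN lt by auto
      next
        case False
        then show ?thesis using prod_ratio_superadditive[of N ?m a b] m mN lt by auto
      qed
      then show ?thesis using sum fa fb 5 by linarith
    qed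
  qed
  then show ?thesis using goal by simp
qed

end
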